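(* Let $F:\Omega\times I\to\Omega\times I$, $F(\omega,x)=(\tau(\omega),f_{\omega_0}(x))$, be a one-step skew product over the Bernoulli shift $\tau$ on $(\Omega,\mathscr F,\mathbb P)=(\mathcal A^{\mathbb N},\mathcal F^{\mathbb N},p^{\mathbb N})$. Assume that: (a) for every $x\in(0,1)$ the sequence $\{X^x_n\}_{n\ge0}$, $X^x_n(\omega)=f^n_\omega(x)$, is conjugate to a random walk on $\mathbb Z$ or $\mathbb R$ with mean zero and positive finite variance; (b) for every $\omega\in\Omega$, $f_\omega$ restricts to a measurable, monotonically increasing ($x\le y\Rightarrow f_\omega(x)\le f_\omega(y)$) map $f_\omega:(0,1)\to(0,1)$; (c) for every $x\in(0,1)$ there exist $\alpha,\beta\in\Omega$ with $f_\alpha(x)<x<f_\beta(x)$; (d) $f_\omega(0)=0$ and $f_\omega(1)=1$ for $\mathbb P$-a.e. $\omega\in\Omega$. Then, for every $x\in(0,1)$, $$\mathcal L(\omega,x)=\{\lambda\delta_0+(1-\lambda)\delta_1:\lambda\in[0,1]\}\quad\text{for }\mathbb P\text{-a.e. }\omega\in\Omega.$$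
   Context: $I=[0,1]$. $\mathcal A$ is an at most countable alphabet, $\mathcal F$ its discrete $\sigma$-algebra, $p$ a probability measure on $\mathcal A$ with $p(a)>0$ for every $a\in\mathcal A$; $\tau$ is the one-sided shift on $\Omega=\mathcal A^{\mathbb N}$. The fiber maps $f_a:I\to I$, $a\in\mathcal A$, are measurable; $f_\omega=f_{\omega_0}$, $f^0_\omega=\mathrm{id}$, $f^n_\omega=f_{\omega_{n-1}}\circ\dots\circ f_{\omega_0}$. Conjugate to a random walk: let $G$ be $\mathbb Z$ or $\mathbb R$ and $\mathcal O(x)=\{X^x_n(\omega):\omega\in\Omega,\ n\ge0\}$. The sequence $\{X^x_n\}_{n\ge0}$ is conjugate to a $G$-valued random walk if there is a strictly monotonic injection $h:\mathcal O(x)\to G$ such that, with $t=h(x)$ and $S^t_n(\omega)=h(f^n_\omega(x))$, the steps $Y^t_n=S^t_n-S^t_{n-1}$, $n\ge1$, are independent and identically distributed. The mean and variance of the random walk are those of $Y^t_1$. $\mathcal L(\omega,x)$ is the set of accumulation points, in the weak$^*$ topology, of the empirical measures $\frac1n\sum_{j=0}^{n-1}\delta_{f^j_\omega(x)}$, $n\ge1$. *)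

theory Defs
  imports "HOL-Probability.Probability"
begin

section \<open>One-step skew products over a Bernoulli shift\<close>

text \<open>
  The alphabet is the whole type \<open>'a\<close>. A \<^typ>\<open>'a pmf\<close> charging every point forces \<open>'a\<close> to be at
  most countable, and \<^const>\<open>measure_pmf\<close> carries the discrete \<open>\<sigma>\<close>-algebra.
\<close>

definition bernoulli_measure :: "'a pmf \<Rightarrow> (nat \<Rightarrow> 'a) measure" where
  "bernoulli_measure p = (\<Pi>\<^sub>M n\<in>(UNIV :: nat set). measure_pmf p)"

definition left_shift :: "(nat \<Rightarrow> 'a) \<Rightarrow> nat \<Rightarrow> 'a" where
  "left_shift \<omega> = (\<lambda>n. \<omega> (Suc n))"

definition skew_product ::
    "('a \<Rightarrow> real \<Rightarrow> real) \<Rightarrow> (nat \<Rightarrow> 'a) \<times> real \<Rightarrow> (nat \<Rightarrow> 'a) \<times> real" where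
  "skew_product f = (\<lambda>(\<omega>, x). (left_shift \<omega>, f (\<omega> 0) x))"

primrec fiber_iter :: "('a \<Rightarrow> real \<Rightarrow> real) \<Rightarrow> (nat \<Rightarrow> 'a) \<Rightarrow> nat \<Rightarrow> real \<Rightarrow> real" where
  "fiber_iter f \<omega> 0 = id"
| "fiber_iter f \<omega> (Suc n) = f (\<omega> n) \<circ> fiber_iter f \<omega> n"

lemma left_shift_funpow: "(left_shift ^^ n) \<omega> k = \<omega> (n + k)"
  by (induction n arbitrary: k) (auto simp: left_shift_def)

lemma skew_product_funpow:
  "(skew_product f ^^ n) (\<omega>, x) = ((left_shift ^^ n) \<omega>, fiber_iter f \<omega> n x)"
proof (induction n)
  case (Suc n)
  then show ?case
    using left_shift_funpow[of n \<omega> 0] by (simp add: skew_product_def)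
qed simp


section \<open>Conjugacy to a random walk\<close>

definition orbit_points :: "('a \<Rightarrow> real \<Rightarrow> real) \<Rightarrow> real \<Rightarrow> real set" where
  "orbit_points f x = {fiber_iter f \<omega> n x | \<omega> n. True}"

definition walk_step ::
    "('a \<Rightarrow> real \<Rightarrow> real) \<Rightarrow> (real \<Rightarrow> real) \<Rightarrow> real \<Rightarrow> nat \<Rightarrow> (nat \<Rightarrow> 'a) \<Rightarrow> real" where
  "walk_step f h x n \<omega> = h (fiber_iter f \<omega> n x) - h (fiber_iter f \<omega> (n - 1) x)"

text \<open>
  The state space \<open>G\<close> is a subset of the reals, to be instantiated with \<^term>\<open>\<int> :: real set\<close> or
  \<^term>\<open>UNIV :: real set\<close>. Strictly monotonic maps may be increasing or decreasing.
  Measurability of the steps is part of \<^const>\<open>prob_space.indep_vars\<close>.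
\<close>

definition conjugates_to_random_walk ::
    "'a pmf \<Rightarrow> ('a \<Rightarrow> real \<Rightarrow> real) \<Rightarrow> real \<Rightarrow> real set \<Rightarrow> (real \<Rightarrow> real) \<Rightarrow> bool" where
  "conjugates_to_random_walk p f x G h \<longleftrightarrow>
     h ` orbit_points f x \<subseteq> G \<and>
     (strict_mono_on (orbit_points f x) h \<or> strict_antimono_on (orbit_points f x) h) \<and>
     prob_space.indep_vars (bernoulli_measure p) (\<lambda>_. borel) (walk_step f h x) {1..} \<and>
     (\<forall>n\<ge>1. distr (bernoulli_measure p) borel (walk_step f h x n) =
             distr (bernoulli_measure p) borel (walk_step f h x 1))"


section \<open>Weak* accumulation points of empirical measures\<close>

abbreviation borel_I :: "real measure" where
  "borel_I \<equiv> restrict_space borel {0..1}"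

definition prob_measures_I :: "real measure set" where
  "prob_measures_I = {\<mu>. prob_space \<mu> \<and> sets \<mu> = sets borel_I}"

text \<open>The coarsest topology making \<open>\<mu> \<mapsto> \<integral>\<phi> d\<mu>\<close> continuous for every continuous \<open>\<phi>\<close> on \<open>[0,1]\<close>.\<close>

definition weak_star_topology :: "real measure topology" where
  "weak_star_topology = topology_generated_by
     {{\<mu> \<in> prob_measures_I. (\<integral>x. \<phi> x \<partial>\<mu>) \<in> U} |
      (\<phi> :: real \<Rightarrow> real) U. continuous_on {0..1} \<phi> \<and> open U}"

lemma topspace_weak_star_topology: "topspace weak_star_topology = prob_measures_I"
proof -
  have "prob_measures_I \<in> {{\<mu> \<in> prob_measures_I. (\<integral>x. \<phi> x \<partial>\<mu>) \<in> U} |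
      (\<phi> :: real \<Rightarrow> real) U. continuous_on {0..1} \<phi> \<and> open U}"
    by (rule CollectI, rule exI[of _ "\<lambda>_. 0"], rule exI[of _ UNIV]) simp
  then show ?thesis
    unfolding weak_star_topology_def topology_generated_by_topspace by blast
qed

text \<open>
  The measure \<open>\<Sum> c \<cdot> \<mu>\<close> over a list of pairs \<open>(c, \<mu>)\<close> of nonnegative weights and measures on
  \<open>[0,1]\<close>; negative weights are truncated to zero.
\<close>

definition lincomb_measure :: "(real \<times> real measure) list \<Rightarrow> real measure" where
  "lincomb_measure cs = measure_of (space borel_I) (sets borel_I)
     (\<lambda>A. \<Sum>(c, \<mu>)\<leftarrow>cs. ennreal c * emeasure \<mu> A)"

lemma sets_lincomb_measure [simp]: "sets (lincomb_measure cs) = sets borel_I"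
  unfolding lincomb_measure_def by (rule sets.sets_measure_of_eq)

lemma emeasure_lincomb_measure:
  assumes "\<And>c \<mu>. (c, \<mu>) \<in> set cs \<Longrightarrow> sets \<mu> = sets borel_I" and "A \<in> sets borel_I"
  shows "emeasure (lincomb_measure cs) A = (\<Sum>(c, \<mu>)\<leftarrow>cs. ennreal c * emeasure \<mu> A)"
  unfolding lincomb_measure_def
proof (rule emeasure_measure_of_sigma)
  show "sigma_algebra (space borel_I) (sets borel_I)"
    by (rule sets.sigma_algebra_axioms)
  show "positive (sets borel_I) (\<lambda>A. \<Sum>(c, \<mu>)\<leftarrow>cs. ennreal c * emeasure \<mu> A)"
    by (induction cs) (auto simp: positive_def)
  show "countably_additive (sets borel_I) (\<lambda>A. \<Sum>(c, \<mu>)\<leftarrow>cs. ennreal c * emeasure \<mu> A)"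
    using assms(1)
  proof (induction cs)
    case Nil
    then show ?case by (simp add: countably_additive_def)
  next
    case (Cons q cs)
    obtain c \<mu> where q: "q = (c, \<mu>)" by (cases q)
    have sets: "sets \<mu> = sets borel_I" using Cons.prems[of c \<mu>] q by simp
    have IH: "countably_additive (sets borel_I) (\<lambda>A. \<Sum>(c, \<mu>)\<leftarrow>cs. ennreal c * emeasure \<mu> A)"
      using Cons.prems by (intro Cons.IH) auto
    show ?case unfolding countably_additive_def
    proof (intro allI impI)
      fix B :: "nat \<Rightarrow> real set"
      assume B: "range B \<subseteq> sets borel_I" "disjoint_family B" "\<Union> (range B) \<in> sets borel_I"
      have "(\<Sum>i. ennreal c * emeasure \<mu> (B i)) = ennreal c * emeasure \<mu> (\<Union> (range B))"
        using B sets by (simp add: suminf_emeasure)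
      moreover have "(\<Sum>i. \<Sum>(c, \<mu>)\<leftarrow>cs. ennreal c * emeasure \<mu> (B i)) =
          (\<Sum>(c, \<mu>)\<leftarrow>cs. ennreal c * emeasure \<mu> (\<Union> (range B)))"
        using IH B unfolding countably_additive_def by blast
      ultimately show "(\<Sum>i. \<Sum>(c, \<mu>)\<leftarrow>q # cs. ennreal c * emeasure \<mu> (B i)) =
          (\<Sum>(c, \<mu>)\<leftarrow>q # cs. ennreal c * emeasure \<mu> (\<Union> (range B)))"
        by (simp add: q suminf_add [symmetric])
    qed
  qed
qed (fact assms(2))

abbreviation dirac :: "real \<Rightarrow> real measure" where
  "dirac \<equiv> return borel_I"

definition empirical_measure ::
    "('a \<Rightarrow> real \<Rightarrow> real) \<Rightarrow> (nat \<Rightarrow> 'a) \<Rightarrow> real \<Rightarrow> nat \<Rightarrow> real measure" where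
  "empirical_measure f \<omega> x n =
     lincomb_measure (map (\<lambda>j. (1 / real n, dirac (fiber_iter f \<omega> j x))) [0..<n])"

text \<open>
  Accumulation points are those of the sequence indexed by \<open>n\<close>: every neighbourhood is visited for
  infinitely many \<open>n\<close>. The index \<open>n = 0\<close> is irrelevant.
\<close>

definition weak_star_accumulation_points ::
    "('a \<Rightarrow> real \<Rightarrow> real) \<Rightarrow> (nat \<Rightarrow> 'a) \<Rightarrow> real \<Rightarrow> real measure set" where
  "weak_star_accumulation_points f \<omega> x =
     {\<mu> \<in> topspace weak_star_topology. \<forall>U. openin weak_star_topology U \<and> \<mu> \<in> U \<longrightarrow>
        (\<exists>\<^sub>F n in sequentially. empirical_measure f \<omega> x n \<in> U)}"

end

theory Submission
  imports Defs
begin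

text \<open>
  Fix \<open>x\<close> in \<open>(0, 1)\<close>. In the coordinate \<open>h\<close> its trajectory is a random walk with centered steps of finite
  positive variance. Replacing \<open>h\<close> by \<open>-h\<close> if necessary, let \<open>h\<close> be increasing. Two almost sure properties
  of the walk matter, collected in \<open>oscillating\<close>:

  \<^item> Every bounded set is visited with frequency \<open>0\<close>. By the central limit theorem the walk is in a
    bounded set at time \<open>n\<close> with probability tending to \<open>0\<close>. To pass from probabilities to frequencies
    along almost every path, cut time into blocks of length \<open>L\<close>. Many visits to an interval in a block
    produce many pairs of times in that block at which the walk takes close values. The proportion of
    such pairs (\<open>close_pairs\<close>) is independent from block to block, and its expectation is
    small for large \<open>L\<close>, so Hoeffding's inequality controls its average over the blocks.

  \<^item> For every level \<open>K\<close> there are infinitely many \<open>n\<close> such that nearly all of the time before \<open>n\<close> is spent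
    above \<open>K\<close>, and infinitely many such that nearly all of it is spent below \<open>-K\<close>. By the central limit
    theorem and Chebyshev's inequality, the former has a probability bounded away from \<open>0\<close> at every
    large time scale (\<open>prob_mostly_high\<close>). Along rapidly growing scales these events are essentially
    independent, so infinitely many of them occur.

  In particular, for almost every \<open>\<omega>\<close> the trajectory of an interior point \<open>y\<close> is infinitely often on either
  side of \<open>y\<close>. With monotonicity of the fiber maps this forces every orbit to accumulate at \<open>0\<close> and
  at \<open>1\<close> (\<open>orbit_above\<close>, \<open>orbit_below\<close>). Hence \<open>h\<close> maps the part of the orbit in a compact subset of
  \<open>(0, 1)\<close> to a bounded set, and the orbit points with very negative or very large \<open>h\<close> are those near \<open>0\<close>
  or near \<open>1\<close>. The two properties of the walk become: compact subsets of \<open>(0, 1)\<close> are visited with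
  frequency \<open>0\<close>, and the proportion of time spent in \<open>(0, 1/2)\<close> has lower limit \<open>0\<close> and upper limit \<open>1\<close>.
  The former forces all accumulation points of the empirical measures to live on \<open>{0, 1}\<close>. As the
  proportion changes by at most \<open>1 / n\<close> at time \<open>n\<close>, it accumulates at every \<open>\<lambda>\<close> in \<open>[0, 1]\<close>, which yields
  all the measures \<open>\<lambda>\<delta>\<^sub>0 + (1 - \<lambda>)\<delta>\<^sub>1\<close>.
\<close>


section \<open>Frequencies and partial sums\<close>

definition partial_sum :: "(nat \<Rightarrow> real) \<Rightarrow> nat \<Rightarrow> real" where
  "partial_sum y n = (\<Sum>i<n. y i)"

definition frequency :: "(nat \<Rightarrow> bool) \<Rightarrow> nat \<Rightarrow> real" where
  "frequency P n = (\<Sum>j<n. of_bool (P j)) / real n"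

lemma frequency_nonneg: "0 \<le> frequency P n"
  by (simp add: frequency_def sum_nonneg)

lemma frequency_mono: "(\<And>j. P j \<Longrightarrow> Q j) \<Longrightarrow> frequency P n \<le> frequency Q n"
  unfolding frequency_def by (intro divide_right_mono sum_mono) auto

lemma frequency_not: "n > 0 \<Longrightarrow> frequency P n = 1 - frequency (\<lambda>j. \<not> P j) n"
proof -
  assume "n > 0"
  have "(\<Sum>j<n. of_bool (P j)) = (\<Sum>j<n. 1 - of_bool (\<not> P j) :: real)"
    by (intro sum.cong) auto
  then show ?thesis
    using \<open>n > 0\<close> unfolding frequency_def by (simp only: sum_subtractf diff_divide_distrib) simp
qed

lemma sum_lessThan_add: "(\<Sum>j<m + n. f j) = (\<Sum>j<m. f j) + (\<Sum>d<n. f (m + d))"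
  for f :: "nat \<Rightarrow> real"
  by (induction n) simp_all

lemma measurable_partial_sum [measurable]:
  "(\<lambda>y. partial_sum y n) \<in> borel_measurable (\<Pi>\<^sub>M i\<in>UNIV. borel)"
  unfolding partial_sum_def by measurable

lemma partial_sum_cong: "(\<And>i. i < n \<Longrightarrow> y i = z i) \<Longrightarrow> partial_sum y n = partial_sum z n"
  by (simp add: partial_sum_def)

lemma partial_sum_add:
  "partial_sum y (m + n) = partial_sum y m + partial_sum (\<lambda>i. y (m + i)) n"
  by (induction n) (simp_all add: partial_sum_def)


section \<open>Stationarity and independence of blocks of increments\<close>

text \<open>
  Independence only speaks about finite subfamilies, so it survives relabelling along an
  injection: transport a finite subfamily with \<open>inv_into\<close>.
\<close>

lemma (in prob_space) indep_vars_reindex: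
  assumes indep: "indep_vars M' X I" and g: "inj_on g J" "g ` J \<subseteq> I"
  shows "indep_vars (\<lambda>j. M' (g j)) (\<lambda>j. X (g j)) J"
  unfolding indep_vars_def2
proof (intro conjI ballI)
  show "random_variable (M' (g j)) (X (g j))" if "j \<in> J" for j
    using indep g(2) that by (auto simp: indep_vars_def2)
  let ?F = "\<lambda>i. {X i -` A \<inter> space M |A. A \<in> sets (M' i)}"
  have F: "indep_sets ?F I" using indep by (simp add: indep_vars_def2)
  show "indep_sets (\<lambda>j. ?F (g j)) J"
  proof (rule indep_setsI)
    show "?F (g j) \<subseteq> events" if "j \<in> J" for j
      using F g(2) that by (auto simp: indep_sets_def)
  next
    fix A K assume K: "K \<noteq> {}" "K \<subseteq> J" "finite K" and A: "\<forall>j\<in>K. A j \<in> ?F (g j)"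
    have inj: "inj_on g K" using g(1) K(2) by (rule inj_on_subset)
    have inv: "inv_into K g (g j) = j" if "j \<in> K" for j using inv_into_f_f[OF inj that] .
    have "prob (\<Inter>i\<in>g ` K. A (inv_into K g i)) = (\<Prod>i\<in>g ` K. prob (A (inv_into K g i)))"
      using K g(2) A inv by (intro indep_setsD[OF F]) auto
    then show "prob (\<Inter>j\<in>K. A j) = (\<Prod>j\<in>K. prob (A j))"
      by (simp add: prod.reindex[OF inj] inv cong: INF_cong prod.cong)
  qed
qed

locale centered_iid = prob_space +
  fixes Y :: "nat \<Rightarrow> 'a \<Rightarrow> real"
  assumes indep: "indep_vars (\<lambda>_. borel) Y UNIV"
    and ident: "\<And>n. distr M borel (Y n) = distr M borel (Y 0)"
    and square_integrable: "integrable M (\<lambda>\<omega>. (Y 0 \<omega>)\<^sup>2)"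
    and mean_zero: "expectation (Y 0) = 0"
    and variance_pos: "0 < variance (Y 0)"
begin

definition sd :: real where "sd = sqrt (variance (Y 0))"

text \<open>
  The increments seen from time \<open>m\<close> on, as a point of the sequence space \<open>\<real>\<^sup>\<nat>\<close>. Every event below is
  of the form \<open>P (tail m \<omega>)\<close> with \<open>P\<close> a measurable property of real sequences, which makes
  stationarity and independence of disjoint time blocks statements about \<open>tail\<close> alone.
\<close>

definition tail :: "nat \<Rightarrow> 'a \<Rightarrow> nat \<Rightarrow> real" where
  "tail m \<omega> i = Y (m + i) \<omega>"

lemma sd_pos: "sd > 0"
  using variance_pos by (simp add: sd_def)

lemma measurable_step [measurable]: "Y n \<in> borel_measurable M"
  using indep by (simp add: indep_vars_def2)

lemma measurable_tail [measurable]: "tail m \<in> measurable M (\<Pi>\<^sub>M i\<in>UNIV. borel)"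
  unfolding tail_def[abs_def] by (rule measurable_PiM_single') auto

lemma tail_tail: "(\<lambda>i. tail m \<omega> (k + i)) = tail (m + k) \<omega>"
  by (simp add: tail_def fun_eq_iff add.assoc)

text \<open>
  Stationarity: by independence the law of the whole sequence is the product of its marginals, and
  the marginals of the shifted sequence are the same.
\<close>

lemma distr_tail:
  "distr M (\<Pi>\<^sub>M i\<in>UNIV. borel) (tail m) = distr M (\<Pi>\<^sub>M i\<in>UNIV. borel) (tail 0)"
proof -
  have *: "distr M (\<Pi>\<^sub>M i\<in>UNIV. borel) (tail m) = (\<Pi>\<^sub>M i\<in>UNIV. distr M borel (Y 0))" for m
  proof -
    have "indep_vars (\<lambda>_. borel) (\<lambda>i. Y (m + i)) UNIV"
      using indep_vars_reindex[OF indep, of "(+) m" UNIV] by simp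
    then have "distr M (\<Pi>\<^sub>M i\<in>UNIV. borel) (\<lambda>\<omega>. \<lambda>i\<in>UNIV. Y (m + i) \<omega>) =
        (\<Pi>\<^sub>M i\<in>UNIV. distr M borel (Y (m + i)))"
      by (subst (asm) indep_vars_iff_distr_eq_PiM') auto
    then show ?thesis
      by (simp add: tail_def[abs_def] ident[of "m + _"] restrict_UNIV)
  qed
  show ?thesis by (simp only: *)
qed

lemma prob_tail:
  assumes "Measurable.pred (\<Pi>\<^sub>M i\<in>UNIV. borel) P"
  shows "prob {\<omega> \<in> space M. P (tail m \<omega>)} = prob {\<omega> \<in> space M. P (tail 0 \<omega>)}"
proof -
  let ?B = "\<Pi>\<^sub>M i\<in>(UNIV::nat set). (borel :: real measure)"
  have "{y \<in> space ?B. P y} \<in> sets ?B" using assms by simp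
  then have "measure (distr M ?B (tail k)) {y \<in> space ?B. P y} = prob {\<omega> \<in> space M. P (tail k \<omega>)}" for k
    by (subst measure_distr) (auto intro!: arg_cong[where f=prob] simp: space_PiM)
  from this[of m] this[of 0] show ?thesis by (simp only: distr_tail[of m])
qed

text \<open>
  Functions of the increments in the consecutive time blocks \<open>[t j, t (j + 1))\<close> are independent.
  The hypothesis \<open>local\<close> expresses that \<open>g j\<close> reads only its own block; values outside the block may
  therefore be replaced by \<open>0\<close>, which turns \<open>g j (tail (t j) \<omega>)\<close> into a function of the restriction of the
  increments to that block.
\<close>

lemma indep_vars_blocks:
  fixes t :: "nat \<Rightarrow> nat" and g :: "nat \<Rightarrow> (nat \<Rightarrow> real) \<Rightarrow> real"
  assumes t: "mono t"
    and g [measurable]: "\<And>j. g j \<in> borel_measurable (\<Pi>\<^sub>M i\<in>UNIV. borel)"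
    and local: "\<And>j y z. (\<And>i. i < t (Suc j) - t j \<Longrightarrow> y i = z i) \<Longrightarrow> g j y = g j z"
  shows "indep_vars (\<lambda>_. borel) (\<lambda>j \<omega>. g j (tail (t j) \<omega>)) UNIV"
proof -
  let ?K = "\<lambda>j. {t j..<t (Suc j)}"
  let ?e = "\<lambda>j r i. if t j + i \<in> ?K j then r (t j + i) else (0::real)"
  have disj: "disjoint_family_on ?K UNIV"
  proof (unfold disjoint_family_on_def, intro ballI impI)
    fix j k :: nat assume "j \<noteq> k"
    then have "Suc j \<le> k \<or> Suc k \<le> j" by auto
    then have "t (Suc j) \<le> t k \<or> t (Suc k) \<le> t j" using t by (auto dest: monoD)
    then show "?K j \<inter> ?K k = {}" by auto
  qed
  have "?e j \<in> measurable (PiM (?K j) (\<lambda>_. borel)) (\<Pi>\<^sub>M i\<in>UNIV. borel)" for j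
  proof (rule measurable_PiM_single')
    fix i :: nat
    show "(\<lambda>r. ?e j r i) \<in> borel_measurable (PiM (?K j) (\<lambda>_. borel))"
      by (cases "t j + i \<in> ?K j") auto
  qed auto
  then have "indep_vars (\<lambda>_. borel) (\<lambda>j \<omega>. g j (?e j (restrict (\<lambda>i. Y i \<omega>) (?K j)))) UNIV"
    by (intro indep_vars_compose2[OF indep_vars_restrict[OF indep _ disj]])
       (auto intro: measurable_compose[OF _ g])
  moreover have "g j (?e j (restrict (\<lambda>i. Y i \<omega>) (?K j))) = g j (tail (t j) \<omega>)" for j \<omega>
    by (rule local) (auto simp: tail_def)
  ultimately show ?thesis by simp
qed

end


section \<open>Second moments and the central limit theorem\<close>

lemma measure_std_normal_singleton: "measure std_normal_distribution {a} = 0"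
proof -
  have "(\<integral>\<^sup>+x. ennreal (std_normal_density x) * indicator {a} x \<partial>lborel) = 0"
    using AE_lborel_singleton[of a]
    by (subst nn_integral_0_iff_AE) (auto elim!: eventually_mono simp: indicator_def)
  then show ?thesis
    by (simp add: measure_def emeasure_density)
qed

context centered_iid
begin

lemma square_integrable_step: "integrable M (\<lambda>\<omega>. (Y n \<omega>)\<^sup>2)"
  and mean_step: "expectation (Y n) = 0"
  and second_moment_step: "expectation (\<lambda>\<omega>. (Y n \<omega>)\<^sup>2) = sd\<^sup>2"
proof -
  have transfer: "integrable M (\<lambda>\<omega>. g (Y k \<omega>)) \<longleftrightarrow> integrable (distr M borel (Y k)) g"
      "expectation (\<lambda>\<omega>. g (Y k \<omega>)) = integral\<^sup>L (distr M borel (Y k)) g"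
    if "g \<in> borel_measurable borel" for g :: "real \<Rightarrow> real" and k
    using that by (simp_all add: integrable_distr_eq integral_distr)
  show "integrable M (\<lambda>\<omega>. (Y n \<omega>)\<^sup>2)"
    using square_integrable transfer(1)[of "\<lambda>x. x\<^sup>2"] ident[of n] by simp
  show "expectation (Y n) = 0"
    using mean_zero transfer(2)[of "\<lambda>x. x"] ident[of n] by simp
  have "expectation (\<lambda>\<omega>. (Y n \<omega>)\<^sup>2) = expectation (\<lambda>\<omega>. (Y 0 \<omega>)\<^sup>2)"
    using transfer(2)[of "\<lambda>x. x\<^sup>2"] ident[of n] by simp
  then show "expectation (\<lambda>\<omega>. (Y n \<omega>)\<^sup>2) = sd\<^sup>2"
    using mean_zero variance_pos by (simp add: sd_def)
qed

lemma integrable_step: "integrable M (Y n)"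
  by (rule square_integrable_imp_integrable[OF _ square_integrable_step]) simp

text \<open>
  The cross terms vanish because \<open>Y n\<close> is centered and independent of the preceding partial sum.
\<close>

lemma second_moment_partial_sum:
  "integrable M (\<lambda>\<omega>. (partial_sum (tail 0 \<omega>) n)\<^sup>2) \<and>
   expectation (\<lambda>\<omega>. (partial_sum (tail 0 \<omega>) n)\<^sup>2) = real n * sd\<^sup>2"
proof (induction n)
  case 0
  then show ?case by (simp add: partial_sum_def)
next
  case (Suc n)
  let ?S = "\<lambda>\<omega>. partial_sum (tail 0 \<omega>) n"
  have "indep_var borel (Y n) borel (\<lambda>\<omega>. \<Sum>i<n. Y i \<omega>)"
    by (rule indep_vars_sum) (auto intro: indep_vars_subset[OF indep])
  then have iv: "indep_var borel (Y n) borel ?S"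
    by (simp add: partial_sum_def tail_def)
  have S: "integrable M ?S"
    by (simp add: partial_sum_def tail_def integrable_step)
  have prod: "integrable M (\<lambda>\<omega>. Y n \<omega> * ?S \<omega>)" "expectation (\<lambda>\<omega>. Y n \<omega> * ?S \<omega>) = 0"
    using indep_var_integrable[OF iv integrable_step S]
      indep_var_lebesgue_integral[OF iv integrable_step S] by (simp_all add: mean_step)
  have eq: "(partial_sum (tail 0 \<omega>) (Suc n))\<^sup>2 = (?S \<omega>)\<^sup>2 + 2 * (Y n \<omega> * ?S \<omega>) + (Y n \<omega>)\<^sup>2" for \<omega>
    by (simp add: partial_sum_def tail_def power2_eq_square algebra_simps)
  show ?case
    unfolding eq using Suc prod square_integrable_step[of n]
    by (simp add: second_moment_step algebra_simps)
qed

lemma prob_partial_sum_ge: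
  assumes "a > 0"
  shows "prob {\<omega> \<in> space M. a \<le> \<bar>partial_sum (tail m \<omega>) n\<bar>} \<le> real n * sd\<^sup>2 / a\<^sup>2"
proof -
  have S: "expectation (\<lambda>\<omega>. partial_sum (tail 0 \<omega>) n) = 0"
    by (simp add: partial_sum_def tail_def integrable_step mean_step)
  have "prob {\<omega> \<in> space M. a \<le> \<bar>partial_sum (tail m \<omega>) n\<bar>} =
      prob {\<omega> \<in> space M. a \<le> \<bar>partial_sum (tail 0 \<omega>) n\<bar>}"
    by (rule prob_tail) measurable
  also have "\<dots> \<le> real n * sd\<^sup>2 / a\<^sup>2"
    using Chebyshev_inequality[of "\<lambda>\<omega>. partial_sum (tail 0 \<omega>) n" a] second_moment_partial_sum[of n] S assms
    by simp
  finally show ?thesis .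
qed

lemma normalized_weak_conv:
  "weak_conv_m (\<lambda>n. distr M borel (\<lambda>\<omega>. partial_sum (tail 0 \<omega>) n / (sd * sqrt n))) std_normal_distribution"
proof -
  have "weak_conv_m (\<lambda>n. distr M borel (\<lambda>\<omega>. (\<Sum>i<n. Y i \<omega>) / sqrt (n * sd\<^sup>2))) std_normal_distribution"
    using central_limit_theorem_zero_mean[OF indep mean_step sd_pos square_integrable_step _ ident]
    by (simp add: mean_step second_moment_step)
  then show ?thesis
    using sd_pos by (simp add: partial_sum_def tail_def real_sqrt_mult mult.commute)
qed

text \<open>
  The central limit theorem at a single level; the normal law has no atoms, so its distribution
  function is continuous at every \<open>a\<close>.
\<close>

lemma tendsto_prob_normalized_le:
  "(\<lambda>n. prob {\<omega> \<in> space M. partial_sum (tail 0 \<omega>) n \<le> a * (sd * sqrt n)}) \<longlonglongrightarrow> cdf std_normal_distribution a"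
proof -
  interpret N: real_distribution std_normal_distribution
    by (rule real_dist_normal_dist)
  have null: "measure std_normal_distribution {a} = 0"
    by (rule measure_std_normal_singleton)
  have "(\<lambda>n. cdf (distr M borel (\<lambda>\<omega>. partial_sum (tail 0 \<omega>) n / (sd * sqrt n))) a)
      \<longlonglongrightarrow> cdf std_normal_distribution a"
    using normalized_weak_conv null unfolding weak_conv_m_def weak_conv_def
    by (simp add: N.isCont_cdf)
  moreover have "eventually (\<lambda>n. cdf (distr M borel (\<lambda>\<omega>. partial_sum (tail 0 \<omega>) n / (sd * sqrt n))) a
      = prob {\<omega> \<in> space M. partial_sum (tail 0 \<omega>) n \<le> a * (sd * sqrt n)}) sequentially"
    using eventually_gt_at_top[of 0]
  proof eventually_elim
    case (elim n)
    then have "0 < sd * sqrt n" using sd_pos by simp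
    then have "(\<lambda>\<omega>. partial_sum (tail 0 \<omega>) n / (sd * sqrt n)) -` {..a} \<inter> space M =
        {\<omega> \<in> space M. partial_sum (tail 0 \<omega>) n \<le> a * (sd * sqrt n)}"
      by (auto simp: pos_divide_le_eq)
    then show ?case
      by (simp add: cdf_def measure_distr)
  qed
  ultimately show ?thesis by (rule Lim_transform_eventually)
qed

lemma cdf_std_normal_less_1: "cdf std_normal_distribution a < 1"
proof -
  interpret N: real_distribution std_normal_distribution
    by (rule real_dist_normal_dist)
  have "measure std_normal_distribution {a<..} \<noteq> 0"
  proof
    assume "measure std_normal_distribution {a<..} = 0"
    then have "emeasure std_normal_distribution {a<..} = 0"
      by (simp add: N.emeasure_eq_measure)
    then have "(\<integral>\<^sup>+x. ennreal (std_normal_density x) * indicator {a<..} x \<partial>lborel) = 0"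
      by (simp add: emeasure_density)
    then have "AE x in lborel. ennreal (std_normal_density x) * indicator {a<..} x = 0"
      by (subst (asm) nn_integral_0_iff_AE) auto
    then have "AE x in lborel. x \<notin> {a<..}"
    proof eventually_elim
      case (elim x)
      then show ?case
        using normal_density_pos[of 1 0 x] by (auto simp: indicator_def split: if_splits)
    qed
    then have "emeasure lborel {a<..} = 0"
      by (subst (asm) AE_iff_measurable[of "{a<..}"]) auto
    moreover have "emeasure lborel {a<..a+1} \<le> emeasure lborel {a<..}"
      by (intro emeasure_mono) auto
    ultimately show False by simp
  qed
  moreover have "measure std_normal_distribution {a<..} = 1 - measure std_normal_distribution {..a}"
    using N.prob_compl[of "{..a}"] by (simp add: Compl_eq_Diff_UNIV[symmetric])
  ultimately show ?thesis
    by (simp add: cdf_def2 less_le)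
qed

end


section \<open>Bounded sets are visited with frequency zero\<close>

context centered_iid
begin

text \<open>
  A fixed interval \<open>[-K, K]\<close> is eventually contained in \<open>[-d sd \<surd>n / 2, d sd \<surd>n / 2]\<close> for any \<open>d > 0\<close>, and the
  normal law gives little mass to a short interval around \<open>0\<close>.
\<close>

lemma tendsto_prob_bounded: "(\<lambda>n. prob {\<omega> \<in> space M. \<bar>partial_sum (tail 0 \<omega>) n\<bar> \<le> K}) \<longlonglongrightarrow> 0"
proof (rule LIMSEQ_I)
  fix r :: real assume "r > 0"
  interpret N: real_distribution std_normal_distribution
    by (rule real_dist_normal_dist)
  let ?F = "cdf std_normal_distribution"
  have "isCont ?F 0"
    using measure_std_normal_singleton by (simp add: N.isCont_cdf)
  then have "\<exists>d>0. \<forall>x. \<bar>x - 0\<bar> < d \<longrightarrow> \<bar>?F x - ?F 0\<bar> < r / 4"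
    using \<open>r > 0\<close> unfolding continuous_at_eps_delta dist_real_def by (meson divide_pos_pos zero_less_numeral)
  then obtain d where d: "d > 0" "\<And>x. \<bar>x\<bar> < d \<Longrightarrow> \<bar>?F x - ?F 0\<bar> < r / 4"
    by auto
  let ?P = "\<lambda>a n. prob {\<omega> \<in> space M. partial_sum (tail 0 \<omega>) n \<le> a * (sd * sqrt n)}"
  have "(\<lambda>n. ?P (d / 2) n - ?P (- (d / 2)) n) \<longlonglongrightarrow> ?F (d / 2) - ?F (- (d / 2))"
    by (intro tendsto_diff tendsto_prob_normalized_le)
  moreover have "?F (d / 2) - ?F (- (d / 2)) < r"
  proof -
    have "\<bar>?F (d / 2) - ?F 0\<bar> < r / 4" "\<bar>?F (- (d / 2)) - ?F 0\<bar> < r / 4"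
      by (rule d(2), use d(1) in simp)+
    then show ?thesis using \<open>r > 0\<close> by linarith
  qed
  ultimately have "eventually (\<lambda>n. ?P (d / 2) n - ?P (- (d / 2)) n < r) sequentially"
    by (rule order_tendstoD)
  moreover have "filterlim (\<lambda>n. d / 2 * (sd * sqrt (real n))) at_top sequentially"
    using d(1) sd_pos
    by (intro filterlim_tendsto_pos_mult_at_top[OF tendsto_const]
        filterlim_compose[OF sqrt_at_top] filterlim_real_sequentially) auto
  then have "eventually (\<lambda>n. K < d / 2 * (sd * sqrt (real n))) sequentially"
    by (simp add: filterlim_at_top_dense)
  ultimately have "eventually (\<lambda>n. norm (prob {\<omega> \<in> space M. \<bar>partial_sum (tail 0 \<omega>) n\<bar> \<le> K} - 0) < r) sequentially"
  proof eventually_elim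
    case (elim n)
    let ?A = "\<lambda>a. {\<omega> \<in> space M. partial_sum (tail 0 \<omega>) n \<le> a * (sd * sqrt n)}"
    have "prob {\<omega> \<in> space M. \<bar>partial_sum (tail 0 \<omega>) n\<bar> \<le> K} \<le> prob (?A (d / 2) - ?A (- (d / 2)))"
      using elim(2) by (intro finite_measure_mono) auto
    also have "\<dots> = ?P (d / 2) n - ?P (- (d / 2)) n"
    proof (rule finite_measure_Diff)
      have "- (d / 2) * (sd * sqrt n) \<le> d / 2 * (sd * sqrt n)"
        using d(1) sd_pos by (intro mult_right_mono) auto
      then show "?A (- (d / 2)) \<subseteq> ?A (d / 2)" by auto
    qed measurable
    finally show ?case using elim(1) by simp
  qed
  then show "\<exists>no. \<forall>n\<ge>no. norm (prob {\<omega> \<in> space M. \<bar>partial_sum (tail 0 \<omega>) n\<bar> \<le> K} - 0) < r"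
    by (simp add: eventually_sequentially)
qed

text \<open>
  The proportion of pairs of times below \<open>L\<close> at which the walk takes \<open>K\<close>-close values. If a walk spends
  the proportion \<open>v\<close> of a time block of length \<open>L\<close> in an interval of length \<open>K\<close>, wherever that interval
  lies, then \<open>v\<^sup>2 \<le> close_pairs K L\<close>. In contrast to \<open>v\<close>, this quantity depends only on the increments
  inside the block, so its values on disjoint blocks are independent.
\<close>

definition close_pairs :: "real \<Rightarrow> nat \<Rightarrow> (nat \<Rightarrow> real) \<Rightarrow> real" where
  "close_pairs K L y =
     (\<Sum>i<L. \<Sum>j<L. of_bool (\<bar>partial_sum y i - partial_sum y j\<bar> \<le> K)) / (real L)\<^sup>2"

lemma measurable_close_pairs [measurable]:
  "close_pairs K L \<in> borel_measurable (\<Pi>\<^sub>M i\<in>UNIV. borel)"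
  unfolding close_pairs_def[abs_def] by measurable

lemma close_pairs_bounds: "0 \<le> close_pairs K L y" "close_pairs K L y \<le> 1"
proof -
  show "0 \<le> close_pairs K L y" by (simp add: close_pairs_def sum_nonneg)
  have "(\<Sum>i<L. \<Sum>j<L. of_bool (\<bar>partial_sum y i - partial_sum y j\<bar> \<le> K)) \<le> (\<Sum>i<L. \<Sum>j<L. (1::real))"
    by (intro sum_mono) auto
  then show "close_pairs K L y \<le> 1"
    by (cases "L = 0") (auto simp: close_pairs_def power2_eq_square)
qed

lemma prob_close_pair:
  "prob {\<omega> \<in> space M. \<bar>partial_sum (tail 0 \<omega>) i - partial_sum (tail 0 \<omega>) j\<bar> \<le> K} =
   prob {\<omega> \<in> space M. \<bar>partial_sum (tail 0 \<omega>) (max i j - min i j)\<bar> \<le> K}"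
proof -
  have *: "prob {\<omega> \<in> space M. \<bar>partial_sum (tail 0 \<omega>) i - partial_sum (tail 0 \<omega>) (i + d)\<bar> \<le> K} =
      prob {\<omega> \<in> space M. \<bar>partial_sum (tail 0 \<omega>) d\<bar> \<le> K}" for i d
  proof -
    have "\<bar>partial_sum (tail 0 \<omega>) i - partial_sum (tail 0 \<omega>) (i + d)\<bar> = \<bar>partial_sum (tail i \<omega>) d\<bar>" for \<omega>
      by (simp add: partial_sum_add tail_tail)
    then show ?thesis by (simp, intro prob_tail) measurable
  qed
  show ?thesis
  proof (cases "i \<le> j")
    case True
    then show ?thesis using *[of i "j - i"] by (simp add: max_def min_def)
  next
    case False
    then show ?thesis using *[of j "i - j"] by (simp add: max_def min_def abs_minus_commute)
  qed
qed

text \<open>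
  The expectation is the average over \<open>i, j < L\<close> of the probability that the walk is in \<open>[-K, K]\<close> at
  time \<open>\<bar>i - j\<bar>\<close>. That probability is small unless \<open>\<bar>i - j\<bar> < D\<close>, which happens for at most \<open>2 D L\<close> of
  the \<open>L\<^sup>2\<close> pairs.
\<close>

lemma expectation_close_pairs_small:
  assumes "e > 0"
  obtains L where "L > 0" "expectation (\<lambda>\<omega>. close_pairs K L (tail 0 \<omega>)) \<le> e"
proof -
  let ?u = "\<lambda>d. prob {\<omega> \<in> space M. \<bar>partial_sum (tail 0 \<omega>) d\<bar> \<le> K}"
  have "eventually (\<lambda>d. ?u d < e / 2) sequentially"
    using order_tendstoD(2)[OF tendsto_prob_bounded[of K], of "e / 2"] assms by simp
  then obtain D where D: "\<And>d. d \<ge> D \<Longrightarrow> ?u d < e / 2"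
    by (auto simp: eventually_sequentially)
  define L where "L = Suc (nat \<lceil>4 * real D / e\<rceil>)"
  have L: "L > 0" "4 * real D / e \<le> real L"
    using real_nat_ceiling_ge[of "4 * real D / e"] by (simp_all add: L_def)
  have "expectation (\<lambda>\<omega>. close_pairs K L (tail 0 \<omega>)) =
      (\<Sum>i<L. \<Sum>j<L. ?u (max i j - min i j)) / (real L)\<^sup>2"
  proof -
    define E where "E i j = {\<omega> \<in> space M. \<bar>partial_sum (tail 0 \<omega>) i - partial_sum (tail 0 \<omega>) j\<bar> \<le> K}" for i j
    have E [measurable]: "E i j \<in> events" for i j unfolding E_def by measurable
    have "integrable M (indicator (E i j) :: 'a \<Rightarrow> real)" for i j
      by (simp add: emeasure_eq_measure)
    then have int: "integrable M (\<lambda>\<omega>. indicator (E i j) \<omega> :: real)" for i j .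
    have "of_bool (\<bar>partial_sum (tail 0 \<omega>) i - partial_sum (tail 0 \<omega>) j\<bar> \<le> K) = (indicator (E i j) \<omega> :: real)"
      if "\<omega> \<in> space M" for i j \<omega>
      using that by (simp add: E_def indicator_def)
    then have "expectation (\<lambda>\<omega>. close_pairs K L (tail 0 \<omega>)) =
        expectation (\<lambda>\<omega>. (\<Sum>i<L. \<Sum>j<L. indicator (E i j) \<omega>) / (real L)\<^sup>2)"
      unfolding close_pairs_def by (intro Bochner_Integration.integral_cong) auto
    also have "\<dots> = (\<Sum>i<L. \<Sum>j<L. prob (E i j)) / (real L)\<^sup>2"
      using int E by (simp add: Bochner_Integration.integral_sum sets.Int_space_eq2)
    also have "\<dots> = (\<Sum>i<L. \<Sum>j<L. prob {\<omega> \<in> space M.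
          \<bar>partial_sum (tail 0 \<omega>) i - partial_sum (tail 0 \<omega>) j\<bar> \<le> K}) / (real L)\<^sup>2"
      by (simp only: E_def)
    finally show ?thesis by (simp only: prob_close_pair)
  qed
  also have "\<dots> \<le> e"
  proof -
    have "(\<Sum>j<L. ?u (max i j - min i j)) \<le> real L * (e / 2) + 2 * real D" for i
    proof -
      have "(\<Sum>j<L. ?u (max i j - min i j)) \<le> (\<Sum>j<L. e / 2 + of_bool (j \<in> {i - D..<i + D}))"
      proof (rule sum_mono)
        fix j
        show "?u (max i j - min i j) \<le> e / 2 + of_bool (j \<in> {i - D..<i + D})"
        proof (cases "D \<le> max i j - min i j")
          case True
          then show ?thesis using D[of "max i j - min i j"] by (simp add: add.commute add_increasing)
        next
          case False
          then have "j \<in> {i - D..<i + D}" by (auto simp: max_def min_def split: if_splits)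
          then show ?thesis using prob_le_1 assms by (simp add: add_increasing)
        qed
      qed
      also have "\<dots> = real L * (e / 2) + real (card ({..<L} \<inter> {i - D..<i + D}))"
        by (auto simp: sum.distrib of_bool_def sum.If_cases intro!: arg_cong[where f=card])
      also have "card ({..<L} \<inter> {i - D..<i + D}) \<le> card {i - D..<i + D}"
        by (intro card_mono) auto
      then have "real (card ({..<L} \<inter> {i - D..<i + D})) \<le> 2 * real D" by simp
      finally show ?thesis by simp
    qed
    then have "(\<Sum>i<L. \<Sum>j<L. ?u (max i j - min i j)) \<le> (\<Sum>i<L. real L * (e / 2) + 2 * real D)"
      by (intro sum_mono) auto
    also have "\<dots> \<le> e * (real L)\<^sup>2"
    proof -
      have DL: "2 * real D \<le> real L * (e / 2)" using L assms by (simp add: field_simps)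
      then have "real L * (real L * (e / 2) + 2 * real D) \<le> real L * (real L * (e / 2) + real L * (e / 2))"
        by (intro mult_left_mono add_left_mono DL) simp
      then show ?thesis by (simp add: power2_eq_square algebra_simps)
    qed
    finally show ?thesis using L(1) by (simp add: pos_divide_le_eq)
  qed
  finally show ?thesis using that L(1) by blast
qed

text \<open>
  A law of large numbers with a wide margin: the blocks are independent and the variables take values
  in \<open>[0, 1]\<close>, so Hoeffding's inequality gives summable tail probabilities.
\<close>

lemma AE_average_close_pairs:
  assumes "e > 0" "L > 0" and mean: "expectation (\<lambda>\<omega>. close_pairs K L (tail 0 \<omega>)) \<le> e"
  shows "AE \<omega> in M. eventually (\<lambda>B. (\<Sum>b<B. close_pairs K L (tail (b * L) \<omega>)) \<le> 2 * e * real B) sequentially"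
proof -
  let ?Z = "\<lambda>b \<omega>. close_pairs K L (tail (b * L) \<omega>)"
  have indep: "indep_vars (\<lambda>_. borel) ?Z UNIV"
  proof (rule indep_vars_blocks)
    show "mono (\<lambda>b. b * L)" by (intro monoI) simp
    fix b :: nat and y z :: "nat \<Rightarrow> real"
    assume "\<And>i. i < Suc b * L - b * L \<Longrightarrow> y i = z i"
    then have "partial_sum y i = partial_sum z i" if "i < L" for i
      using that by (intro partial_sum_cong) simp
    then show "close_pairs K L y = close_pairs K L z"
      by (simp add: close_pairs_def)
  qed measurable
  have mean_block: "expectation (?Z b) \<le> e" for b
  proof -
    have *: "expectation (\<lambda>\<omega>. close_pairs K L (tail k \<omega>)) =
        integral\<^sup>L (distr M (\<Pi>\<^sub>M i\<in>UNIV. borel) (tail 0)) (close_pairs K L)" for k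
      by (subst distr_tail[of k, symmetric]) (simp add: integral_distr)
    from *[of "b * L"] *[of 0] mean show ?thesis by simp
  qed
  have tail_bound: "prob {\<omega> \<in> space M. 2 * e * real B \<le> (\<Sum>b<B. ?Z b \<omega>)} \<le> exp (- 2 * e\<^sup>2) ^ B" for B
  proof (cases "B = 0")
    case False
    interpret H: Hoeffding_ineq M "{..<B}" ?Z "\<lambda>_. 0" "\<lambda>_. 1" "\<Sum>b<B. expectation (?Z b)"
    proof unfold_locales
      show "indep_vars (\<lambda>_. borel) ?Z {..<B}"
        by (rule indep_vars_subset[OF indep]) simp
    qed (auto simp: close_pairs_bounds)
    have "(\<Sum>b<B. expectation (?Z b)) \<le> (\<Sum>b<B. e)"
      by (intro sum_mono mean_block)
    then have "prob {\<omega> \<in> space M. 2 * e * real B \<le> (\<Sum>b<B. ?Z b \<omega>)} \<le>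
        prob {\<omega> \<in> space M. (\<Sum>b<B. expectation (?Z b)) + e * real B \<le> (\<Sum>b<B. ?Z b \<omega>)}"
      by (intro finite_measure_mono) (auto simp: algebra_simps)
    also have "\<dots> \<le> exp (- 2 * (e * real B)\<^sup>2 / (\<Sum>b<B. (1 - 0)\<^sup>2))"
      using False assms(1) by (intro H.Hoeffding_ineq_ge) auto
    also have "- 2 * (e * real B)\<^sup>2 / (\<Sum>b<B. (1 - 0)\<^sup>2) = real B * (- 2 * e\<^sup>2)"
      using False by (simp add: power2_eq_square)
    finally show ?thesis by (simp only: exp_of_nat_mult)
  qed simp
  have "summable (\<lambda>B. exp (- 2 * e\<^sup>2) ^ B)"
    using assms(1) by (intro summable_geometric) simp
  then have "summable (\<lambda>B. prob {\<omega> \<in> space M. 2 * e * real B \<le> (\<Sum>b<B. ?Z b \<omega>)})"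
  proof (rule summable_comparison_test')
    show "norm (prob {\<omega> \<in> space M. 2 * e * real B \<le> (\<Sum>b<B. ?Z b \<omega>)}) \<le> exp (- 2 * e\<^sup>2) ^ B"
      if "B \<ge> 0" for B
      unfolding real_norm_def abs_of_nonneg[OF measure_nonneg] by (rule tail_bound)
  qed
  then have "AE \<omega> in M. eventually (\<lambda>B. \<omega> \<in> space M - {\<omega> \<in> space M. 2 * e * real B \<le> (\<Sum>b<B. ?Z b \<omega>)}) sequentially"
    by (intro borel_cantelli_AE1) (auto simp: emeasure_eq_measure)
  then show ?thesis
    by (rule AE_mp) (intro AE_I2 impI, auto elim!: eventually_mono)
qed

text \<open>
  Two visits to \<open>[-K, K]\<close> in the same block form a \<open>2 K\<close>-close pair, so the proportion \<open>v\<close> of visits in a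
  block satisfies \<open>v\<^sup>2 \<le> close_pairs (2 K) L\<close>. The inequality \<open>2 v e \<le> e\<^sup>2 + v\<^sup>2\<close> makes the bound linear in
  \<open>close_pairs\<close>, so that it can be summed over the blocks.
\<close>

lemma visits_le_close_pairs:
  assumes "L > 0" "e > 0"
  shows "(\<Sum>j<B * L. of_bool (\<bar>partial_sum (tail 0 \<omega>) j\<bar> \<le> K)) \<le>
    real L * (e * real B + (\<Sum>b<B. close_pairs (2 * K) L (tail (b * L) \<omega>)) / e) / 2"
proof -
  let ?I = "\<lambda>j. of_bool (\<bar>partial_sum (tail 0 \<omega>) j\<bar> \<le> K) :: real"
  let ?Z = "\<lambda>b. close_pairs (2 * K) L (tail (b * L) \<omega>)"
  have block: "(\<Sum>i<L. ?I (b * L + i)) \<le> real L * (e + ?Z b / e) / 2" for b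
  proof -
    define v where "v = (\<Sum>i<L. ?I (b * L + i)) / real L"
    have "v\<^sup>2 = (\<Sum>i<L. \<Sum>j<L. ?I (b * L + i) * ?I (b * L + j)) / (real L)\<^sup>2"
      unfolding v_def power_divide by (simp only: power2_eq_square sum_product)
    also have "\<dots> \<le> ?Z b"
      unfolding close_pairs_def
    proof (intro divide_right_mono sum_mono)
      fix i j
      show "?I (b * L + i) * ?I (b * L + j) \<le>
          of_bool (\<bar>partial_sum (tail (b * L) \<omega>) i - partial_sum (tail (b * L) \<omega>) j\<bar> \<le> 2 * K)"
        by (auto simp: partial_sum_add[of "tail 0 \<omega>"] tail_tail)
    qed simp
    finally have "v\<^sup>2 \<le> ?Z b" .
    have "2 * v * e \<le> e\<^sup>2 + v\<^sup>2" using sum_squares_bound[of v e] by (simp add: algebra_simps)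
    with \<open>v\<^sup>2 \<le> ?Z b\<close> have "2 * v * e \<le> e\<^sup>2 + ?Z b" by simp
    then have "v \<le> (e + ?Z b / e) / 2"
      using assms(2) by (simp add: field_simps power2_eq_square)
    then show ?thesis using assms(1) by (simp add: v_def field_simps)
  qed
  have "(\<Sum>j<B * L. ?I j) = (\<Sum>b<B. \<Sum>i<L. ?I (b * L + i))"
  proof (induction B)
    case (Suc B)
    have "Suc B * L = B * L + L" by simp
    then show ?case using Suc sum_lessThan_add[of ?I "B * L" L] by (simp only: sum.lessThan_Suc)
  qed simp
  also have "\<dots> \<le> (\<Sum>b<B. real L * (e + ?Z b / e) / 2)"
    by (intro sum_mono block)
  also have "\<dots> = real L * (e * real B + (\<Sum>b<B. ?Z b) / e) / 2"
    by (simp add: sum_distrib_left[symmetric] sum_divide_distrib[symmetric] sum.distrib mult.commute)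
  finally show ?thesis .
qed

text \<open>
  Choose \<open>L\<close> such that the expectation of \<open>close_pairs\<close> is at most \<open>e\<^sup>2\<close>. Whole blocks then contribute a
  proportion of visits of at most \<open>3 e / 2\<close>, and completing the last block at most doubles it.
\<close>

lemma AE_frequency_bounded_eventually_le:
  assumes "e > 0"
  shows "AE \<omega> in M. eventually (\<lambda>n. frequency (\<lambda>j. \<bar>partial_sum (tail 0 \<omega>) j\<bar> \<le> K) n \<le> 3 * e) sequentially"
proof -
  obtain L where L: "L > 0" "expectation (\<lambda>\<omega>. close_pairs (2 * K) L (tail 0 \<omega>)) \<le> e\<^sup>2"
    using expectation_close_pairs_small[of "e\<^sup>2" "2 * K"] assms by auto
  have "AE \<omega> in M. eventually (\<lambda>B. (\<Sum>b<B. close_pairs (2 * K) L (tail (b * L) \<omega>)) \<le> 2 * e\<^sup>2 * real B) sequentially"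
    using assms L by (intro AE_average_close_pairs) auto
  then show ?thesis
  proof eventually_elim
    case (elim \<omega>)
    let ?I = "\<lambda>j. of_bool (\<bar>partial_sum (tail 0 \<omega>) j\<bar> \<le> K) :: real"
    obtain B0 where B0: "\<And>B. B \<ge> B0 \<Longrightarrow> (\<Sum>b<B. close_pairs (2 * K) L (tail (b * L) \<omega>)) \<le> 2 * e\<^sup>2 * real B"
      using elim by (auto simp: eventually_sequentially)
    have "frequency (\<lambda>j. \<bar>partial_sum (tail 0 \<omega>) j\<bar> \<le> K) n \<le> 3 * e" if n: "n \<ge> max (B0 * L) (Suc L)" for n
    proof -
      \<comment> \<open>Round \<open>n\<close> up to a whole number of blocks; this at most doubles it because \<open>n > L\<close>.\<close>
      define B where "B = Suc (n div L)"
      have "n div L \<ge> B0" using n L(1) by (simp add: less_eq_div_iff_mult_less_eq)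
      then have "B \<ge> B0" by (simp add: B_def)
      have nB: "n \<le> B * L" "B * L \<le> n + L"
        using L(1) by (auto simp: B_def dividend_less_div_times less_imp_le div_times_less_eq_dividend add.commute)
      have "(\<Sum>j<n. ?I j) \<le> (\<Sum>j<B * L. ?I j)"
        using nB by (intro sum_mono2) auto
      also have "\<dots> \<le> real L * (e * real B + (\<Sum>b<B. close_pairs (2 * K) L (tail (b * L) \<omega>)) / e) / 2"
        using L(1) assms by (rule visits_le_close_pairs)
      also have "\<dots> \<le> real L * (e * real B + (2 * e\<^sup>2 * real B) / e) / 2"
        using B0[OF \<open>B \<ge> B0\<close>] assms by (intro divide_right_mono mult_left_mono add_left_mono) auto
      also have "\<dots> = 3 / 2 * e * real (B * L)"
        using assms by (simp add: power2_eq_square field_simps)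
      also have "\<dots> \<le> 3 / 2 * e * (2 * real n)"
      proof (intro mult_left_mono)
        have "B * L \<le> 2 * n" using nB n by simp
        then show "real (B * L) \<le> 2 * real n" by (metis of_nat_mono of_nat_mult of_nat_numeral)
      qed (use assms in simp)
      finally show ?thesis
        using n by (simp add: frequency_def pos_divide_le_eq)
    qed
    then show ?case unfolding eventually_sequentially by blast
  qed
qed

lemma AE_frequency_bounded:
  "AE \<omega> in M. \<forall>K::nat. (\<lambda>n. frequency (\<lambda>j. \<bar>partial_sum (tail 0 \<omega>) j\<bar> \<le> real K) n) \<longlonglongrightarrow> 0"
proof (unfold AE_all_countable, intro allI)
  fix K :: nat
  have "AE \<omega> in M. \<forall>r::nat. eventually (\<lambda>n. frequency (\<lambda>j. \<bar>partial_sum (tail 0 \<omega>) j\<bar> \<le> real K) n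
      \<le> 3 * (1 / real (Suc r))) sequentially"
    unfolding AE_all_countable by (intro allI AE_frequency_bounded_eventually_le) simp
  then show "AE \<omega> in M. (\<lambda>n. frequency (\<lambda>j. \<bar>partial_sum (tail 0 \<omega>) j\<bar> \<le> real K) n) \<longlonglongrightarrow> 0"
  proof eventually_elim
    case (elim \<omega>)
    show ?case
    proof (rule LIMSEQ_I)
      fix e :: real assume "e > 0"
      then obtain r where r: "1 / real (Suc r) < e / 3"
        using reals_Archimedean[of "e / 3"] by (auto simp: inverse_eq_divide)
      obtain N where N: "frequency (\<lambda>j. \<bar>partial_sum (tail 0 \<omega>) j\<bar> \<le> real K) n \<le> 3 * (1 / real (Suc r))"
        if "n \<ge> N" for n
        using elim[rule_format, of r] unfolding eventually_sequentially by blast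
      have "norm (frequency (\<lambda>j. \<bar>partial_sum (tail 0 \<omega>) j\<bar> \<le> real K) n - 0) < e" if "n \<ge> N" for n
        using N[OF that] r frequency_nonneg[of "\<lambda>j. \<bar>partial_sum (tail 0 \<omega>) j\<bar> \<le> real K" n] by simp
      then show "\<exists>no. \<forall>n\<ge>no. norm (frequency (\<lambda>j. \<bar>partial_sum (tail 0 \<omega>) j\<bar> \<le> real K) n - 0) < e"
        by blast
    qed
  qed
qed

end


section \<open>Long excursions\<close>

text \<open>
  The limit superior of the events has probability at least \<open>c\<close>, hence \<open>1\<close> by the zero-one law.
\<close>

lemma (in prob_space) AE_infinitely_often_of_indep_events:
  fixes A :: "nat \<Rightarrow> 'a set"
  assumes indep: "indep_events A UNIV" and c: "c > 0" "\<And>k. c \<le> prob (A k)"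
  shows "AE \<omega> in M. \<exists>\<^sub>\<infinity>k. \<omega> \<in> A k"
proof -
  have A [measurable]: "A k \<in> events" for k
    using indep by (auto simp: indep_events_def)
  let ?U = "\<lambda>n. \<Union>m\<in>{n..}. A m"
  have "(\<lambda>n. prob (?U n)) \<longlonglongrightarrow> prob (\<Inter>n. ?U n)"
  proof (rule finite_Lim_measure_decseq)
    show "decseq ?U" unfolding decseq_def by (intro allI impI UN_mono) auto
  qed auto
  moreover have "c \<le> prob (?U n)" for n
    by (rule order_trans[OF c(2)[of n]]) (intro finite_measure_mono, auto)
  ultimately have "c \<le> prob (\<Inter>n. ?U n)"
    by (intro LIMSEQ_le_const) auto
  then have "prob (\<Inter>n. ?U n) = 1"
    using borel_0_1_law[OF indep] c(1) by auto
  then have "AE \<omega> in M. \<omega> \<in> (\<Inter>n. ?U n)"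
    by (subst (asm) prob_eq_1) auto
  then show ?thesis
    by eventually_elim (auto simp: INFM_nat_le)
qed

context centered_iid
begin

text \<open>
  By Chebyshev's inequality, at each time \<open>d < q m\<close> the walk is below \<open>-2 q sd \<surd>m\<close> with probability at
  most \<open>1 / (4 q)\<close>. Hence the expected number of such times is at most \<open>m / 4\<close>, and Markov's
  inequality bounds the probability that there are more than \<open>m\<close> of them by \<open>1 / 4\<close>.
\<close>

lemma prob_low_visits:
  fixes q :: nat
  assumes q: "q > 0" and m: "m > 0"
  shows "3 / 4 \<le> prob {\<omega> \<in> space M.
    (\<Sum>d<q * m - m. of_bool (partial_sum (tail m \<omega>) d \<le> - (2 * q * sd * sqrt m))) \<le> real m}"
    (is "_ \<le> prob {\<omega> \<in> space M. ?N \<omega> \<le> real m}")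
proof -
  define E where "E d = {\<omega> \<in> space M. partial_sum (tail m \<omega>) d \<le> - (2 * q * sd * sqrt m)}" for d
  have E [measurable]: "E d \<in> events" for d unfolding E_def by measurable
  have int: "integrable M (\<lambda>\<omega>. indicator (E d) \<omega> :: real)" for d
    by (simp add: emeasure_eq_measure)
  have N: "?N \<omega> = (\<Sum>d<q * m - m. indicator (E d) \<omega>)" if "\<omega> \<in> space M" for \<omega>
    using that by (simp add: E_def indicator_def of_bool_def)
  have a: "2 * q * sd * sqrt m > 0" using q m sd_pos by simp
  have PE: "prob (E d) \<le> real q / (4 * (real q)\<^sup>2)" if d: "d < q * m" for d
  proof -
    have "prob (E d) \<le> prob {\<omega> \<in> space M. 2 * q * sd * sqrt m \<le> \<bar>partial_sum (tail m \<omega>) d\<bar>}"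
      by (intro finite_measure_mono) (auto simp: E_def)
    also have "\<dots> \<le> real d * sd\<^sup>2 / (2 * q * sd * sqrt m)\<^sup>2"
      by (rule prob_partial_sum_ge[OF a])
    also have "\<dots> \<le> (real q * real m) * sd\<^sup>2 / (2 * q * sd * sqrt m)\<^sup>2"
      using d by (intro divide_right_mono mult_right_mono) (auto simp flip: of_nat_mult)
    also have "\<dots> = real q / (4 * (real q)\<^sup>2)"
      using m sd_pos by (simp add: power_mult_distrib)
    finally show ?thesis .
  qed
  have "prob {\<omega> \<in> space M. \<not> ?N \<omega> \<le> real m} \<le>
      prob {\<omega> \<in> space M. real m \<le> (\<Sum>d<q * m - m. indicator (E d) \<omega>)}"
  proof (intro finite_measure_mono subsetI)
    fix \<omega> assume "\<omega> \<in> {\<omega> \<in> space M. \<not> ?N \<omega> \<le> real m}"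
    then have "\<omega> \<in> space M" "\<not> ?N \<omega> \<le> real m" by blast+
    then show "\<omega> \<in> {\<omega> \<in> space M. real m \<le> (\<Sum>d<q * m - m. indicator (E d) \<omega>)}"
      using N[of \<omega>] by simp
  qed measurable
  also have "\<dots> \<le> expectation (\<lambda>\<omega>. \<Sum>d<q * m - m. indicator (E d) \<omega>) / real m"
    using m int by (intro integral_Markov_inequality_measure[where A="{}"]) (auto intro!: sum_nonneg)
  also have "expectation (\<lambda>\<omega>. \<Sum>d<q * m - m. indicator (E d) \<omega>) = (\<Sum>d<q * m - m. prob (E d))"
    using int E by (simp add: Bochner_Integration.integral_sum sets.Int_space_eq2)
  also have "(\<Sum>d<q * m - m. prob (E d)) \<le> (\<Sum>d<q * m - m. real q / (4 * (real q)\<^sup>2))"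
    by (intro sum_mono PE) simp
  also have "\<dots> \<le> (real q * real m) * (real q / (4 * (real q)\<^sup>2))"
  proof -
    have "real (q * m - m) \<le> real q * real m" by (simp flip: of_nat_mult)
    then show ?thesis by (simp only: sum_constant card_lessThan) (intro mult_right_mono, auto)
  qed
  also have "\<dots> / real m = 1 / 4"
    using q m by (simp add: power2_eq_square)
  finally have "prob {\<omega> \<in> space M. \<not> ?N \<omega> \<le> real m} \<le> 1 / 4"
    using m by (simp add: divide_right_mono)
  then show ?thesis
    using prob_neg[of "\<lambda>\<omega>. ?N \<omega> \<le> real m"] by simp
qed

text \<open>
  The walk spends all but a proportion \<open>2 / q\<close> of the time interval \<open>[0, q m)\<close> above any given level with
  a probability that is bounded away from \<open>0\<close> as \<open>m \<rightarrow> \<infinity>\<close>. One way to do so is to climb above \<open>4 q sd \<surd>m\<close> by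
  time \<open>m\<close>, which has a positive limiting probability by the central limit theorem, and then to fall
  back by \<open>2 q sd \<surd>m\<close> during at most \<open>m\<close> of the remaining times. The two events depend on disjoint blocks
  of increments, hence they are independent.
\<close>

lemma prob_mostly_high:
  fixes q :: nat
  assumes q: "q > 0"
  obtains c where "c > 0"
    "\<And>K. eventually (\<lambda>m. c \<le> prob {\<omega> \<in> space M.
       frequency (\<lambda>j. partial_sum (tail 0 \<omega>) j \<le> K) (q * m) \<le> 2 / real q}) sequentially"
proof -
  define c where "c = (1 - cdf std_normal_distribution (4 * q)) / 2"
  have c: "c > 0" using cdf_std_normal_less_1 by (simp add: c_def)
  have "cdf std_normal_distribution (4 * q) < 1 - c" using c by (simp add: c_def field_simps)
  then have ev1: "eventually (\<lambda>m. prob {\<omega> \<in> space M. partial_sum (tail 0 \<omega>) m \<le> (4 * q) * (sd * sqrt m)} < 1 - c) sequentially"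
    by (rule order_tendstoD(2)[OF tendsto_prob_normalized_le])
  have main: "eventually (\<lambda>m. 3 / 4 * c \<le> prob {\<omega> \<in> space M.
       frequency (\<lambda>j. partial_sum (tail 0 \<omega>) j \<le> K) (q * m) \<le> 2 / real q}) sequentially" for K
  proof -
    have "filterlim (\<lambda>m. 2 * q * sd * sqrt (real m)) at_top sequentially"
      using q sd_pos
      by (intro filterlim_tendsto_pos_mult_at_top[OF tendsto_const]
          filterlim_compose[OF sqrt_at_top] filterlim_real_sequentially) auto
    then have "eventually (\<lambda>m. K < 2 * q * sd * sqrt (real m)) sequentially"
      by (simp add: filterlim_at_top_dense)
    with ev1 eventually_gt_at_top[of 0] show ?thesis
    proof eventually_elim
      case (elim m)
      \<comment> \<open>Two blocks, \<open>[0, m)\<close> and \<open>[m, q m)\<close>, followed by empty ones.\<close>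
      let ?t = "\<lambda>j::nat. if j = 0 then 0 else if j = 1 then m else q * m"
      let ?N = "\<lambda>y. \<Sum>d<q * m - m. of_bool (partial_sum y d \<le> - (2 * q * sd * sqrt m)) :: real"
      let ?g = "\<lambda>j y. if j = 0 then partial_sum y m else if j = Suc 0 then ?N y else 0"
      let ?X = "\<lambda>j \<omega>. ?g j (tail (?t j) \<omega>)"
      let ?A = "{\<omega> \<in> space M. 4 * q * (sd * sqrt m) < partial_sum (tail 0 \<omega>) m}"
      let ?C = "{\<omega> \<in> space M. ?N (tail m \<omega>) \<le> real m}"
      have "indep_vars (\<lambda>_. borel) ?X UNIV"
      proof (rule indep_vars_blocks)
        show "mono ?t" using q by (intro monoI) auto
        show "?g j \<in> borel_measurable (\<Pi>\<^sub>M i\<in>UNIV. borel)" for j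
          by (cases "j = 0"; cases "j = Suc 0") simp_all
        show "?g j y = ?g j z" if "\<And>i. i < ?t (Suc j) - ?t j \<Longrightarrow> y i = z i" for j y z
        proof -
          consider "j = 0" | "j = Suc 0" | "j > Suc 0" by linarith
          then show ?thesis
          proof cases
            case 1
            then show ?thesis using that by (simp cong: partial_sum_cong)
          next
            case 2
            then have "partial_sum y d = partial_sum z d" if "d < q * m - m" for d
              using that \<open>\<And>i. i < ?t (Suc j) - ?t j \<Longrightarrow> y i = z i\<close> by (intro partial_sum_cong) simp
            then show ?thesis using 2 by simp
          qed auto
        qed
      qed
      then have "indep_vars (\<lambda>_. borel) ?X {0, 1}" by (rule indep_vars_subset) simp
      then have "prob (\<Inter>j\<in>{0,1}. ?X j -` (if j = 0 then {4 * q * (sd * sqrt m)<..} else {..real m}) \<inter> space M) =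
          (\<Prod>j\<in>{0,1}. prob (?X j -` (if j = 0 then {4 * q * (sd * sqrt m)<..} else {..real m}) \<inter> space M))"
        by (rule indep_varsD_finite) auto
      moreover have "?X 0 -` {4 * q * (sd * sqrt m)<..} \<inter> space M = ?A" "?X (Suc 0) -` {..real m} \<inter> space M = ?C"
        by auto
      ultimately have AC: "prob (?A \<inter> ?C) = prob ?A * prob ?C"
        by simp
      have "c \<le> prob ?A"
        using elim(1) prob_neg[of "\<lambda>\<omega>. partial_sum (tail 0 \<omega>) m \<le> 4 * q * (sd * sqrt m)"] by (simp add: not_le)
      moreover have "3 / 4 \<le> prob ?C"
        using q elim(2) by (rule prob_low_visits)
      ultimately have "c * (3 / 4) \<le> prob ?A * prob ?C"
        by (rule mult_mono) (simp_all add: measure_nonneg del: sum_of_bool_eq)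
      also have "\<dots> = prob (?A \<inter> ?C)" by (rule AC[symmetric])
      also have "\<dots> \<le> prob {\<omega> \<in> space M. frequency (\<lambda>j. partial_sum (tail 0 \<omega>) j \<le> K) (q * m) \<le> 2 / real q}"
      proof (intro finite_measure_mono subsetI)
        fix \<omega> assume w: "\<omega> \<in> ?A \<inter> ?C"
        let ?I = "\<lambda>j. of_bool (partial_sum (tail 0 \<omega>) j \<le> K) :: real"
        have "q * m = m + (q * m - m)" using q by (cases q) auto
        then have "(\<Sum>j<q * m. ?I j) = (\<Sum>j<m. ?I j) + (\<Sum>d<q * m - m. ?I (m + d))"
          using sum_lessThan_add[of ?I m "q * m - m"] by simp
        also have "\<dots> \<le> (\<Sum>j<m. 1) + ?N (tail m \<omega>)"
        proof (intro add_mono sum_mono)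
          fix d
          have "partial_sum (tail 0 \<omega>) (m + d) > 4 * q * (sd * sqrt m) + partial_sum (tail m \<omega>) d"
            using w by (simp add: partial_sum_add tail_tail)
          then show "?I (m + d) \<le> of_bool (partial_sum (tail m \<omega>) d \<le> - (2 * q * sd * sqrt m))"
            using elim(3) by auto
        qed auto
        also have "\<dots> \<le> 2 * real m" using w by simp
        finally show "\<omega> \<in> {\<omega> \<in> space M. frequency (\<lambda>j. partial_sum (tail 0 \<omega>) j \<le> K) (q * m) \<le> 2 / real q}"
          using w q elim(2) by (simp add: frequency_def field_simps)
      qed (simp add: frequency_def)
      finally show ?case by (simp add: mult.commute)
    qed
  qed
  show ?thesis by (rule that[OF _ main]) (use c in simp)
qed

text \<open>
  Choose block boundaries \<open>t k\<close> growing so fast that the past \<open>[0, t k)\<close> is at most a proportion \<open>1 / q\<close> of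
  \<open>[0, t (k + 1))\<close>. Inside each block the walk, restarted from \<open>0\<close>, spends most of the time above \<open>2 t k\<close>
  with probability at least \<open>c\<close>, independently of the other blocks; almost surely this happens for
  infinitely many \<open>k\<close>. As \<open>t k \<ge> 2 ^ k\<close>, Chebyshev's inequality and the Borel-Cantelli lemma give
  \<open>\<bar>S (t k)\<bar> < t k\<close> for large \<open>k\<close>, so the walk itself is then above \<open>t k\<close> at these times.
\<close>

lemma AE_frequently_mostly_high_of_ratio:
  fixes q :: nat
  assumes q: "q > 0"
  shows "AE \<omega> in M. \<forall>K::nat. \<exists>\<^sub>\<infinity>n. frequency (\<lambda>j. partial_sum (tail 0 \<omega>) j \<le> real K) n \<le> 3 / real q"
proof -
  obtain c where c: "c > 0" "\<And>K. eventually (\<lambda>m. c \<le> prob {\<omega> \<in> space M.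
       frequency (\<lambda>j. partial_sum (tail 0 \<omega>) j \<le> K) (q * m) \<le> 2 / real q}) sequentially"
    using prob_mostly_high[OF q] by blast
  let ?P = "\<lambda>K n. prob {\<omega> \<in> space M. frequency (\<lambda>j. partial_sum (tail 0 \<omega>) j \<le> K) n \<le> 2 / real q}"
  have "\<exists>t. \<forall>k. 2 ^ k \<le> t k \<and> (t k < t (Suc k) \<and> q * t k \<le> t (Suc k) \<and> c \<le> ?P (2 * real (t k)) (t (Suc k) - t k))"
  proof (rule dependent_nat_choice)
    show "\<exists>x. 2 ^ 0 \<le> (x::nat)" by auto
  next
    fix x k :: nat
    assume "2 ^ k \<le> x"
    have "eventually (\<lambda>m. c \<le> ?P (2 * real x) (q * m) \<and> x + 2 ^ Suc k \<le> m) sequentially"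
      by (intro eventually_conj c eventually_ge_at_top)
    then obtain m where m: "c \<le> ?P (2 * real x) (q * m)" "x + 2 ^ Suc k \<le> m"
      by (auto simp: eventually_sequentially)
    have "m \<le> q * m" using q by simp
    moreover have "q * x \<le> q * m" using m(2) by (intro mult_le_mono2) linarith
    moreover have "(2::nat) ^ Suc k > 0" by simp
    ultimately have "2 ^ Suc k \<le> x + q * m" "x < x + q * m" "q * x \<le> x + q * m"
      using m(2) by linarith+
    then show "\<exists>y. 2 ^ Suc k \<le> y \<and> x < y \<and> q * x \<le> y \<and> c \<le> ?P (2 * real x) (y - x)"
      using m(1) by (intro exI[of _ "x + q * m"]) simp
  qed
  then obtain t where t: "\<And>k. 2 ^ k \<le> t k" "\<And>k. t k < t (Suc k)" "\<And>k. q * t k \<le> t (Suc k)"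
      "\<And>k. c \<le> ?P (2 * real (t k)) (t (Suc k) - t k)"
    by blast
  let ?f = "\<lambda>k y. frequency (\<lambda>j. partial_sum y j \<le> 2 * real (t k)) (t (Suc k) - t k)"
  let ?A = "\<lambda>k. {\<omega> \<in> space M. ?f k (tail (t k) \<omega>) \<le> 2 / real q}"
  have f [measurable]: "?f k \<in> borel_measurable (\<Pi>\<^sub>M i\<in>UNIV. borel)" for k
    unfolding frequency_def by measurable
  have "indep_vars (\<lambda>_. borel) (\<lambda>k \<omega>. ?f k (tail (t k) \<omega>)) UNIV"
  proof (rule indep_vars_blocks[OF _ f])
    show "mono t" using t(2) by (simp add: mono_iff_le_Suc less_imp_le)
    fix k and y z :: "nat \<Rightarrow> real"
    assume "\<And>i. i < t (Suc k) - t k \<Longrightarrow> y i = z i"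
    then have "partial_sum y j = partial_sum z j" if "j < t (Suc k) - t k" for j
      using that by (intro partial_sum_cong) simp
    then show "?f k y = ?f k z" by (simp add: frequency_def)
  qed
  then have "indep_events ?A UNIV"
    by (rule indep_eventsI_indep_vars) simp
  moreover have "c \<le> prob (?A k)" for k
  proof -
    have "prob (?A k) = ?P (2 * real (t k)) (t (Suc k) - t k)"
      by (rule prob_tail) measurable
    then show ?thesis using t(4)[of k] by simp
  qed
  ultimately have "AE \<omega> in M. \<exists>\<^sub>\<infinity>k. \<omega> \<in> ?A k"
    by (rule AE_infinitely_often_of_indep_events[OF _ c(1)])
  moreover have "AE \<omega> in M. eventually (\<lambda>k. \<omega> \<in> space M - {\<omega> \<in> space M. real (t k) \<le> \<bar>partial_sum (tail 0 \<omega>) (t k)\<bar>}) sequentially"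
  proof (rule borel_cantelli_AE1)
    have "summable (\<lambda>k. sd\<^sup>2 * (1 / 2) ^ k)"
      by (intro summable_mult summable_geometric) simp
    then show "summable (\<lambda>k. prob {\<omega> \<in> space M. real (t k) \<le> \<bar>partial_sum (tail 0 \<omega>) (t k)\<bar>})"
    proof (rule summable_comparison_test')
      fix k :: nat
      have pos: "(2::real) ^ k \<le> real (t k)" using t(1)[of k] by (metis of_nat_le_iff of_nat_numeral of_nat_power)
      have "(0::real) < 2 ^ k" by simp
      with pos have pos': "0 < real (t k)" by linarith
      have "prob {\<omega> \<in> space M. real (t k) \<le> \<bar>partial_sum (tail 0 \<omega>) (t k)\<bar>} \<le> real (t k) * sd\<^sup>2 / (real (t k))\<^sup>2"
        using pos' by (rule prob_partial_sum_ge)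
      also have "\<dots> = sd\<^sup>2 / real (t k)" by (simp add: power2_eq_square)
      also have "\<dots> \<le> sd\<^sup>2 / 2 ^ k"
        using pos pos' by (intro divide_left_mono mult_pos_pos) auto
      finally show "norm (prob {\<omega> \<in> space M. real (t k) \<le> \<bar>partial_sum (tail 0 \<omega>) (t k)\<bar>}) \<le> sd\<^sup>2 * (1 / 2) ^ k"
        by (simp add: power_one_over)
    qed
  qed (auto simp: emeasure_eq_measure)
  ultimately show ?thesis
  proof eventually_elim
    case (elim \<omega>)
    show ?case
    proof
      fix K :: nat
      let ?I = "\<lambda>j. of_bool (partial_sum (tail 0 \<omega>) j \<le> real K) :: real"
      obtain k0 where k0: "\<And>k. k \<ge> k0 \<Longrightarrow> \<bar>partial_sum (tail 0 \<omega>) (t k)\<bar> < real (t k)"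
        using elim(2) by (auto simp: eventually_sequentially not_le)
      have t_ge: "k \<le> t k" for k
        using t(1)[of k] less_exp[of k] by linarith
      show "\<exists>\<^sub>\<infinity>n. frequency (\<lambda>j. partial_sum (tail 0 \<omega>) j \<le> real K) n \<le> 3 / real q"
        unfolding INFM_nat_le
      proof
        fix n0 :: nat
        obtain k where k: "k \<ge> max n0 (max K k0)" "\<omega> \<in> ?A k"
          using elim(1) unfolding INFM_nat_le by blast
        let ?n = "t (Suc k)" and ?d = "t (Suc k) - t k"
        have d: "?n = t k + ?d" using t(2)[of k] by simp
        have "(\<Sum>j<?n. ?I j) = (\<Sum>j<t k. ?I j) + (\<Sum>i<?d. ?I (t k + i))"
          using sum_lessThan_add[of ?I "t k" ?d] d by simp
        also have "\<dots> \<le> (\<Sum>j<t k. 1) + (\<Sum>i<?d. of_bool (partial_sum (tail (t k) \<omega>) i \<le> 2 * real (t k)))"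
        proof (intro add_mono sum_mono)
          fix i
          have "real K \<le> real (t k)" using t_ge[of k] k(1) by simp
          then show "?I (t k + i) \<le> of_bool (partial_sum (tail (t k) \<omega>) i \<le> 2 * real (t k))"
            using k0[of k] k(1) by (auto simp: partial_sum_add tail_tail)
        qed auto
        also have "\<dots> \<le> real (t k) + 2 / real q * real ?d"
          using k(2) t(2)[of k] by (simp add: frequency_def pos_divide_le_eq)
        also have "\<dots> \<le> real ?n / real q + 2 / real q * real ?n"
        proof (intro add_mono mult_left_mono)
          have "real q * real (t k) \<le> real ?n" using t(3)[of k] by (metis of_nat_le_iff of_nat_mult)
          then show "real (t k) \<le> real ?n / real q" using q by (simp add: field_simps)
        qed auto
        finally have "frequency (\<lambda>j. partial_sum (tail 0 \<omega>) j \<le> real K) ?n \<le> 3 / real q"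
          using t(2)[of k] q by (simp add: frequency_def field_simps)
        moreover have "?n \<ge> n0" using t_ge[of k] k(1) t(2)[of k] by simp
        ultimately show "\<exists>n\<ge>n0. frequency (\<lambda>j. partial_sum (tail 0 \<omega>) j \<le> real K) n \<le> 3 / real q"
          by blast
      qed
    qed
  qed
qed

lemma AE_frequently_mostly_high:
  "AE \<omega> in M. \<forall>(K::nat) (r::nat). \<exists>\<^sub>\<infinity>n.
     frequency (\<lambda>j. partial_sum (tail 0 \<omega>) j \<le> real K) n \<le> 1 / real (Suc r)"
proof -
  have three_pos: "3 * Suc r > 0" for r by simp
  have "AE \<omega> in M. \<exists>\<^sub>\<infinity>n. frequency (\<lambda>j. partial_sum (tail 0 \<omega>) j \<le> real K) n \<le> 1 / real (Suc r)" for K r :: nat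
    using AE_frequently_mostly_high_of_ratio[OF three_pos[of r]]
  proof eventually_elim
    case (elim \<omega>)
    have "3 / real (3 * Suc r) = 1 / real (Suc r)" by (simp add: field_simps)
    with elim show ?case by simp
  qed
  then show ?thesis by (simp add: AE_all_countable)
qed

end


section \<open>Oscillation of centered random walks\<close>

text \<open>
  The almost sure properties of a centered random walk on which the theorem rests: bounded sets have
  frequency zero, and for infinitely many \<open>n\<close> nearly all of the time before \<open>n\<close> is spent above a given
  level, and likewise below. The definition is invariant under \<open>s \<mapsto> -s\<close>.
\<close>

definition oscillating :: "(nat \<Rightarrow> real) \<Rightarrow> bool" where
  "oscillating s \<longleftrightarrow>
     (\<forall>K::nat. frequency (\<lambda>j. \<bar>s j\<bar> \<le> real K) \<longlonglongrightarrow> 0) \<and>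
     (\<forall>(K::nat) (r::nat). \<exists>\<^sub>\<infinity>n. frequency (\<lambda>j. s j \<le> real K) n \<le> 1 / real (Suc r)) \<and>
     (\<forall>(K::nat) (r::nat). \<exists>\<^sub>\<infinity>n. frequency (\<lambda>j. - s j \<le> real K) n \<le> 1 / real (Suc r))"

lemma exceeds_of_low_frequency:
  assumes "\<exists>\<^sub>\<infinity>n. frequency (\<lambda>j. s j \<le> real K) n \<le> 1 / real (Suc 1)"
  shows "\<exists>\<^sub>\<infinity>j. real K < s j"
  unfolding INFM_nat_le
proof (rule allI, rule ccontr)
  fix N assume neg: "\<not> (\<exists>j\<ge>N. real K < s j)"
  obtain n where n: "n \<ge> 2 * N + 1" "frequency (\<lambda>j. s j \<le> real K) n \<le> 1 / 2"
    using assms[unfolded INFM_nat_le, rule_format, of "2 * N + 1"] by auto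
  have "real n - real N = (\<Sum>j\<in>{N..<n}. of_bool (s j \<le> real K))"
    using neg n(1) by (simp add: not_less)
  also have "\<dots> \<le> (\<Sum>j<n. of_bool (s j \<le> real K))"
    by (intro sum_mono2) auto
  also have "\<dots> \<le> real n / 2"
    using n by (simp add: frequency_def field_simps)
  finally show False using n(1) by simp
qed

context centered_iid
begin

lemma centered_iid_uminus: "centered_iid M (\<lambda>n \<omega>. - Y n \<omega>)"
proof
  show "indep_vars (\<lambda>_. borel) (\<lambda>n \<omega>. - Y n \<omega>) UNIV"
    by (rule indep_vars_compose2[OF indep]) simp
  have *: "distr M borel (\<lambda>\<omega>. - Y k \<omega>) = distr (distr M borel (Y k)) borel uminus" for k
    by (simp add: distr_distr comp_def)
  show "distr M borel (\<lambda>\<omega>. - Y n \<omega>) = distr M borel (\<lambda>\<omega>. - Y 0 \<omega>)" for n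
    unfolding * ident[of n] ..
qed (use square_integrable mean_zero variance_pos in simp_all)

lemma AE_oscillating: "AE \<omega> in M. oscillating (\<lambda>n. \<Sum>i<n. Y i \<omega>)"
proof -
  interpret neg: centered_iid M "\<lambda>n \<omega>. - Y n \<omega>" by (rule centered_iid_uminus)
  have S: "partial_sum (tail 0 \<omega>) = (\<lambda>n. \<Sum>i<n. Y i \<omega>)"
    and neg_S: "partial_sum (neg.tail 0 \<omega>) = (\<lambda>n. - (\<Sum>i<n. Y i \<omega>))" for \<omega>
    by (simp_all add: partial_sum_def tail_def neg.tail_def fun_eq_iff sum_negf)
  show ?thesis
    using AE_frequency_bounded AE_frequently_mostly_high neg.AE_frequently_mostly_high
    unfolding S neg_S by eventually_elim (simp add: oscillating_def)
qed

end

lemma oscillating_imp_infinitely_often: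
  assumes "oscillating s"
  shows "\<exists>\<^sub>\<infinity>j. 0 < s j" "\<exists>\<^sub>\<infinity>j. s j < 0"
proof -
  have "\<exists>\<^sub>\<infinity>n. frequency (\<lambda>j. s j \<le> real 0) n \<le> 1 / real (Suc 1)"
      "\<exists>\<^sub>\<infinity>n. frequency (\<lambda>j. - s j \<le> real 0) n \<le> 1 / real (Suc 1)"
    using assms unfolding oscillating_def by blast+
  from this[THEN exceeds_of_low_frequency] show "\<exists>\<^sub>\<infinity>j. 0 < s j" "\<exists>\<^sub>\<infinity>j. s j < 0"
    by simp_all
qed


section \<open>Weak* accumulation points of empirical measures\<close>

text \<open>
  Finite weighted sums of Dirac measures are images of probability mass functions, for which
  integrals are known.
\<close>

lemma empirical_measure_eq_distr:
  assumes "n > 0" "\<And>j. fiber_iter f \<omega> j x \<in> {0..1}"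
  shows "empirical_measure f \<omega> x n =
    distr (measure_pmf (pmf_of_set {..<n})) borel_I (\<lambda>j. fiber_iter f \<omega> j x)"
proof (rule measure_eqI)
  fix A assume "A \<in> sets (empirical_measure f \<omega> x n)"
  then have A: "A \<in> sets borel_I" by (simp add: empirical_measure_def)
  let ?X = "\<lambda>j. fiber_iter f \<omega> j x"
  have X: "?X \<in> measure_pmf (pmf_of_set {..<n}) \<rightarrow>\<^sub>M borel_I"
    using assms(2) by (simp add: space_restrict_space)
  have inv: "ennreal (1 / real n) = 1 / of_nat n"
    using assms(1) by (simp add: divide_ennreal[symmetric] ennreal_of_nat_eq_real_of_nat)
  have "emeasure (empirical_measure f \<omega> x n) A = (\<Sum>j\<leftarrow>[0..<n]. ennreal (1 / real n) * indicator A (?X j))"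
    unfolding empirical_measure_def
    using A by (subst emeasure_lincomb_measure) (auto simp: comp_def)
  also have "\<dots> = (\<Sum>j<n. indicator A (?X j)) / of_nat n"
    by (simp add: interv_sum_list_conv_sum_set_nat atLeast0LessThan inv sum_distrib_left[symmetric]
        divide_ennreal_def mult.commute)
  also have "\<dots> = (\<integral>\<^sup>+j. indicator A (?X j) \<partial>measure_pmf (pmf_of_set {..<n}))"
    using assms(1) by (subst nn_integral_pmf_of_set) auto
  also have "\<dots> = (\<integral>\<^sup>+y. indicator A y \<partial>distr (measure_pmf (pmf_of_set {..<n})) borel_I ?X)"
    using A X by (subst nn_integral_distr) auto
  also have "\<dots> = emeasure (distr (measure_pmf (pmf_of_set {..<n})) borel_I ?X) A"
    using A by (intro nn_integral_indicator) simp
  finally show "emeasure (empirical_measure f \<omega> x n) A = emeasure (distr (measure_pmf (pmf_of_set {..<n})) borel_I ?X) A" .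
qed (simp add: empirical_measure_def)

lemma two_point_measure_eq_distr:
  assumes "l \<in> {0..1}"
  shows "lincomb_measure [(l, dirac 0), (1 - l, dirac 1)] =
    distr (measure_pmf (bernoulli_pmf l)) borel_I (\<lambda>b. if b then 0 else 1)"
proof (rule measure_eqI)
  fix A assume "A \<in> sets (lincomb_measure [(l, dirac 0), (1 - l, dirac 1)])"
  then have A: "A \<in> sets borel_I" by simp
  let ?X = "\<lambda>b. if b then 0 else 1 :: real"
  have X: "?X \<in> measure_pmf (bernoulli_pmf l) \<rightarrow>\<^sub>M borel_I"
    by (simp add: space_restrict_space)
  have "emeasure (lincomb_measure [(l, dirac 0), (1 - l, dirac 1)]) A =
      ennreal l * indicator A 0 + ennreal (1 - l) * indicator A 1"
    using A by (subst emeasure_lincomb_measure) auto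
  also have "\<dots> = (\<integral>\<^sup>+b. indicator A (?X b) \<partial>measure_pmf (bernoulli_pmf l))"
    using assms by (subst nn_integral_bernoulli_pmf) (auto simp: mult.commute)
  also have "\<dots> = (\<integral>\<^sup>+y. indicator A y \<partial>distr (measure_pmf (bernoulli_pmf l)) borel_I ?X)"
    using A X by (subst nn_integral_distr) auto
  also have "\<dots> = emeasure (distr (measure_pmf (bernoulli_pmf l)) borel_I ?X) A"
    using A by (intro nn_integral_indicator) simp
  finally show "emeasure (lincomb_measure [(l, dirac 0), (1 - l, dirac 1)]) A =
      emeasure (distr (measure_pmf (bernoulli_pmf l)) borel_I ?X) A" .
qed simp

lemma continuous_on_borel_I:
  fixes \<phi> :: "real \<Rightarrow> real"
  shows "continuous_on {0..1} \<phi> \<Longrightarrow> \<phi> \<in> borel_measurable borel_I"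
  by (rule borel_measurable_continuous_on_restrict)

lemma
  assumes "n > 0" "\<And>j. fiber_iter f \<omega> j x \<in> {0..1}"
  shows empirical_measure_in_prob_measures_I: "empirical_measure f \<omega> x n \<in> prob_measures_I"
    and integral_empirical_measure: "continuous_on {0..1} \<phi> \<Longrightarrow>
      (\<integral>y. \<phi> y \<partial>empirical_measure f \<omega> x n) = (\<Sum>j<n. \<phi> (fiber_iter f \<omega> j x)) / real n"
proof -
  have X: "(\<lambda>j. fiber_iter f \<omega> j x) \<in> measure_pmf (pmf_of_set {..<n}) \<rightarrow>\<^sub>M borel_I"
    using assms(2) by (simp add: space_restrict_space)
  show "empirical_measure f \<omega> x n \<in> prob_measures_I"
    unfolding prob_measures_I_def empirical_measure_eq_distr[OF assms]
    using X by (auto intro: measure_pmf.prob_space_distr)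
  assume "continuous_on {0..1} \<phi>"
  then show "(\<integral>y. \<phi> y \<partial>empirical_measure f \<omega> x n) = (\<Sum>j<n. \<phi> (fiber_iter f \<omega> j x)) / real n"
    unfolding empirical_measure_eq_distr[OF assms]
    using X assms(1) by (subst integral_distr) (auto simp: continuous_on_borel_I integral_pmf_of_set lessThan_empty_iff)
qed

lemma
  assumes "l \<in> {0..1}"
  shows two_point_measure_in_prob_measures_I:
      "lincomb_measure [(l, dirac 0), (1 - l, dirac 1)] \<in> prob_measures_I"
    and integral_two_point_measure: "continuous_on {0..1} \<phi> \<Longrightarrow>
      (\<integral>y. \<phi> y \<partial>lincomb_measure [(l, dirac 0), (1 - l, dirac 1)]) = l * \<phi> 0 + (1 - l) * \<phi> 1"
proof -
  have X: "(\<lambda>b. if b then 0 else 1 :: real) \<in> measure_pmf (bernoulli_pmf l) \<rightarrow>\<^sub>M borel_I"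
    by (simp add: space_restrict_space)
  show "lincomb_measure [(l, dirac 0), (1 - l, dirac 1)] \<in> prob_measures_I"
    unfolding prob_measures_I_def two_point_measure_eq_distr[OF assms]
    using X by (auto intro: measure_pmf.prob_space_distr)
  assume "continuous_on {0..1} \<phi>"
  then show "(\<integral>y. \<phi> y \<partial>lincomb_measure [(l, dirac 0), (1 - l, dirac 1)]) = l * \<phi> 0 + (1 - l) * \<phi> 1"
    unfolding two_point_measure_eq_distr[OF assms]
    using X assms by (subst integral_distr) (auto simp: continuous_on_borel_I integral_bernoulli_pmf mult.commute)
qed

text \<open>
  On \<open>[0, 1]\<close> the function \<open>x (1 - x)\<close> is nonnegative and vanishes exactly at the endpoints, so a
  probability measure that integrates it to \<open>0\<close> lives on \<open>{0, 1}\<close>.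
\<close>

lemma two_point_measureI:
  assumes \<mu>: "\<mu> \<in> prob_measures_I" and int: "(\<integral>x. x * (1 - x) \<partial>\<mu>) = 0"
  shows "\<exists>l\<in>{0..1}. \<mu> = lincomb_measure [(l, dirac 0), (1 - l, dirac 1)]"
proof -
  interpret prob_space \<mu> using \<mu> by (simp add: prob_measures_I_def)
  have sets [measurable_cong]: "sets \<mu> = sets borel_I" using \<mu> by (simp add: prob_measures_I_def)
  then have space: "space \<mu> = {0..1}"
    by (simp add: sets_eq_imp_space_eq space_restrict_space)
  have meas: "(\<lambda>x. x * (1 - x)) \<in> borel_measurable \<mu>"
    using continuous_on_borel_I[of "\<lambda>x. x * (1 - x)"] by (simp add: measurable_cong_sets[OF sets refl] continuous_intros)
  have bounds: "0 \<le> x * (1 - x)" "x * (1 - x) \<le> 1" if "x \<in> space \<mu>" for x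
    using that by (auto simp: space intro: mult_le_one)
  have "integrable \<mu> (\<lambda>x. x * (1 - x))"
    using bounds meas by (intro integrable_const_bound[where B=1] AE_I2) auto
  then have "AE x in \<mu>. x * (1 - x) = 0"
    using int bounds by (subst (asm) integral_nonneg_eq_0_iff_AE) auto
  then have AE: "AE x in \<mu>. x = 0 \<or> x = 1"
    by eventually_elim auto
  have pt: "{0} \<in> sets borel_I" "{1} \<in> sets borel_I"
    by (auto simp: sets_restrict_space_iff)
  have em: "emeasure \<mu> A = indicator A 0 * emeasure \<mu> {0} + indicator A 1 * emeasure \<mu> {1}"
    if A: "A \<in> sets borel_I" for A
  proof -
    have "emeasure \<mu> A = (\<integral>\<^sup>+x. indicator A x \<partial>\<mu>)" using A sets by simp
    also have "\<dots> = (\<integral>\<^sup>+x. indicator A 0 * indicator {0} x + indicator A 1 * indicator {1} x \<partial>\<mu>)"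
      using AE by (intro nn_integral_cong_AE) (auto elim!: eventually_mono)
    also have "\<dots> = indicator A 0 * emeasure \<mu> {0} + indicator A 1 * emeasure \<mu> {1}"
      using pt sets by (simp add: nn_integral_add nn_integral_cmult)
    finally show ?thesis .
  qed
  define l where "l = measure \<mu> {0}"
  have l: "l \<in> {0..1}" by (simp add: l_def)
  have "1 = emeasure \<mu> {0} + emeasure \<mu> {1}"
    using em[of "{0..1}"] emeasure_space_1 by (simp add: space sets_restrict_space_iff)
  then have "1 = l + measure \<mu> {1}"
    unfolding l_def emeasure_eq_measure by (simp flip: ennreal_plus ennreal_1)
  then have e: "emeasure \<mu> {0} = ennreal l" "emeasure \<mu> {1} = ennreal (1 - l)"
    by (simp_all add: emeasure_eq_measure l_def)
  have "\<mu> = lincomb_measure [(l, dirac 0), (1 - l, dirac 1)]"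
  proof (rule measure_eqI)
    fix A assume "A \<in> sets \<mu>"
    then have A: "A \<in> sets borel_I" using sets by simp
    show "emeasure \<mu> A = emeasure (lincomb_measure [(l, dirac 0), (1 - l, dirac 1)]) A"
      using A by (subst emeasure_lincomb_measure) (auto simp: em[OF A] e mult.commute)
  qed (simp add: sets)
  with l show ?thesis by blast
qed

text \<open>
  Convergence of the integrals of all continuous functions is convergence in the weak* topology. It
  suffices to treat the generating sets, since the property passes to finite intersections and to
  unions.
\<close>

lemma eventually_in_weak_star_open:
  assumes "openin weak_star_topology U" "\<mu> \<in> U"
    and \<nu>: "eventually (\<lambda>k. \<nu> k \<in> prob_measures_I) F"
    and lim: "\<And>\<phi> :: real \<Rightarrow> real. continuous_on {0..1} \<phi> \<Longrightarrow> ((\<lambda>k. \<integral>x. \<phi> x \<partial>\<nu> k) \<longlongrightarrow> (\<integral>x. \<phi> x \<partial>\<mu>)) F"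
  shows "eventually (\<lambda>k. \<nu> k \<in> U) F"
  using openin_topology_generated_by[OF assms(1)[unfolded weak_star_topology_def]] assms(2)
proof (induction rule: generate_topology_on.induct)
  case (Int a b)
  then show ?case by (auto intro: eventually_conj)
next
  case (UN K)
  then obtain k where "k \<in> K" "\<mu> \<in> k" by blast
  with UN.IH[of k] show ?case by (auto elim: eventually_mono)
next
  case (Basis s)
  then obtain \<phi> :: "real \<Rightarrow> real" and V where s: "s = {\<mu> \<in> prob_measures_I. (\<integral>x. \<phi> x \<partial>\<mu>) \<in> V}"
    and \<phi>: "continuous_on {0..1} \<phi>" and V: "open V" by blast
  have "(\<integral>x. \<phi> x \<partial>\<mu>) \<in> V" using Basis s by simp
  from topological_tendstoD[OF lim[OF \<phi>] V this] \<nu> show ?case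
    unfolding s by eventually_elim simp
qed simp

text \<open>
  Consecutive frequencies differ by at most \<open>1 / (n + 1)\<close>, so on its way from near \<open>0\<close> to near \<open>1\<close> the
  frequency comes close to every intermediate value.
\<close>

lemma frequency_subsequence:
  fixes P :: "nat \<Rightarrow> bool"
  assumes low: "\<And>e. e > 0 \<Longrightarrow> \<exists>\<^sub>\<infinity>n. frequency P n < e"
    and high: "\<And>e. e > 0 \<Longrightarrow> \<exists>\<^sub>\<infinity>n. 1 - e < frequency P n"
    and l: "l \<in> {0..1}"
  obtains r where "strict_mono r" "(\<lambda>k. frequency P (r k)) \<longlonglongrightarrow> l"
proof -
  let ?u = "frequency P"
  have step: "?u (Suc n) \<le> ?u n + 1 / real (Suc n)" for n
  proof (cases "n = 0")
    case False
    have "?u (Suc n) = (\<Sum>j<n. of_bool (P j)) / real (Suc n) + of_bool (P n) / real (Suc n)"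
      by (simp add: frequency_def add_divide_distrib)
    also have "\<dots> \<le> (\<Sum>j<n. of_bool (P j)) / real n + 1 / real (Suc n)"
      using False by (intro add_mono divide_left_mono divide_right_mono sum_nonneg) auto
    finally show ?thesis by (simp add: frequency_def)
  qed (simp add: frequency_def)
  have close: "\<exists>n\<ge>N. \<bar>?u n - l\<bar> \<le> e" if e: "e > 0" for e N
  proof -
    define N' where "N' = N + Suc (nat \<lceil>1 / e\<rceil>)"
    have N': "1 / real n \<le> e" if "n \<ge> N'" for n
    proof -
      have "1 / e \<le> real (nat \<lceil>1 / e\<rceil>)" by (rule real_nat_ceiling_ge)
      also have "nat \<lceil>1 / e\<rceil> \<le> n" using that unfolding N'_def by linarith
      then have "real (nat \<lceil>1 / e\<rceil>) \<le> real n" by (rule of_nat_mono)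
      finally show ?thesis using e that by (simp add: N'_def field_simps)
    qed
    obtain a where a: "a \<ge> N'" "?u a < e"
      using low[OF e] unfolding INFM_nat_le by blast
    obtain b where b: "b \<ge> a" "1 - e < ?u b"
      using high[OF e] unfolding INFM_nat_le by blast
    \<comment> \<open>The first time from \<open>a\<close> on at which the frequency is not below \<open>l - e\<close>: the step leading to it is too
      short to overshoot \<open>l + e\<close>.\<close>
    define n where "n = (LEAST n. n \<ge> a \<and> l - e \<le> ?u n)"
    have ex: "b \<ge> a \<and> l - e \<le> ?u b" using b l by simp
    have n: "n \<ge> a" "l - e \<le> ?u n"
      using LeastI[of "\<lambda>n. n \<ge> a \<and> l - e \<le> ?u n", OF ex] by (simp_all add: n_def)
    have "?u n \<le> l + e"
    proof (cases "n = a")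
      case True
      then show ?thesis using a l by simp
    next
      case False
      then obtain m where m: "n = Suc m" "m \<ge> a" using n(1) by (cases n) auto
      then have "\<not> l - e \<le> ?u m"
        using not_less_Least[of m "\<lambda>n. n \<ge> a \<and> l - e \<le> ?u n"] by (simp add: n_def[symmetric])
      moreover have "1 / real (Suc m) \<le> e" using N'[of n] m a n by simp
      ultimately show ?thesis using step[of m] e unfolding m(1) by linarith
    qed
    then show ?thesis using n a N'_def by (intro exI[of _ n]) auto
  qed
  have "\<exists>r. \<forall>k. \<bar>?u (r k) - l\<bar> \<le> 1 / real (Suc k) \<and> r k < (r (Suc k) :: nat)"
  proof (rule dependent_nat_choice)
    show "\<exists>x. \<bar>?u x - l\<bar> \<le> 1 / real (Suc 0)" using close[of 1 0] by auto
    fix x k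
    show "\<exists>y. \<bar>?u y - l\<bar> \<le> 1 / real (Suc (Suc k)) \<and> x < y"
      using close[of "1 / real (Suc (Suc k))" "Suc x"] by (auto simp: Suc_le_eq)
  qed
  then obtain r where r: "\<And>k. \<bar>?u (r k) - l\<bar> \<le> 1 / real (Suc k)" "\<And>k. r k < (r (Suc k) :: nat)"
    by blast
  have "(\<lambda>k. ?u (r k) - l) \<longlonglongrightarrow> 0"
    using r(1) LIMSEQ_inverse_real_of_nat
    by (intro Lim_null_comparison[of "\<lambda>k. ?u (r k) - l" "\<lambda>k. inverse (real (Suc k))"])
      (auto simp: inverse_eq_divide)
  then have "(\<lambda>k. ?u (r k)) \<longlonglongrightarrow> l" by (simp add: LIM_zero_iff)
  moreover have "strict_mono r" using r(2) by (simp add: strict_mono_Suc_iff)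
  ultimately show ?thesis using that by blast
qed

text \<open>
  As compact subsets of \<open>(0, 1)\<close> are visited with frequency zero, replacing \<open>\<phi>\<close> by its value at the
  nearer endpoint costs a small error at points near \<open>0\<close> and \<open>1\<close> and a bounded error at a negligible
  proportion of times.
\<close>

lemma average_close_to_endpoint_values:
  fixes X :: "nat \<Rightarrow> real" and \<phi> :: "real \<Rightarrow> real"
  assumes X: "\<And>j. X j \<in> {0<..<1}"
    and compact: "\<And>a b. 0 < a \<Longrightarrow> b < 1 \<Longrightarrow> frequency (\<lambda>j. a \<le> X j \<and> X j \<le> b) \<longlonglongrightarrow> 0"
    and \<phi>: "continuous_on {0..1} \<phi>"
  shows "(\<lambda>n. (\<Sum>j<n. \<phi> (X j)) / real n -
      (frequency (\<lambda>j. X j < 1 / 2) n * \<phi> 0 + (1 - frequency (\<lambda>j. X j < 1 / 2) n) * \<phi> 1)) \<longlonglongrightarrow> 0"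
proof (rule LIMSEQ_I)
  fix e :: real assume e: "e > 0"
  let ?u = "frequency (\<lambda>j. X j < 1 / 2)"
  let ?\<psi> = "\<lambda>j. if X j < 1 / 2 then \<phi> 0 else \<phi> 1"
  have "bounded (\<phi> ` {0..1})"
    by (intro compact_imp_bounded compact_continuous_image \<phi>) simp
  then obtain B where B: "B > 0" "\<And>y. y \<in> {0..1} \<Longrightarrow> \<bar>\<phi> y\<bar> \<le> B"
    by (auto simp: bounded_pos)
  obtain d0 where d0: "d0 > 0" "\<And>y. y \<in> {0..1} \<Longrightarrow> \<bar>y - 0\<bar> < d0 \<Longrightarrow> \<bar>\<phi> y - \<phi> 0\<bar> < e / 2"
    using \<phi>[unfolded continuous_on_iff, rule_format, of 0 "e / 2"] e by (auto simp: dist_real_def)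
  obtain d1 where d1: "d1 > 0" "\<And>y. y \<in> {0..1} \<Longrightarrow> \<bar>y - 1\<bar> < d1 \<Longrightarrow> \<bar>\<phi> y - \<phi> 1\<bar> < e / 2"
    using \<phi>[unfolded continuous_on_iff, rule_format, of 1 "e / 2"] e by (auto simp: dist_real_def)
  define d where "d = min (1 / 2) (min d0 d1)"
  have d: "d > 0" "d \<le> 1 / 2" "d \<le> d0" "d \<le> d1" using d0(1) d1(1) by (auto simp: d_def)
  let ?m = "frequency (\<lambda>j. d \<le> X j \<and> X j \<le> 1 - d)"
  have pointwise: "\<bar>\<phi> (X j) - ?\<psi> j\<bar> \<le> e / 2 + 2 * B * of_bool (d \<le> X j \<and> X j \<le> 1 - d)" for j
  proof (cases "d \<le> X j \<and> X j \<le> 1 - d")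
    case True
    have "\<bar>\<phi> (X j)\<bar> \<le> B" "\<bar>\<phi> 0\<bar> \<le> B" "\<bar>\<phi> 1\<bar> \<le> B" using X[of j] by (auto intro!: B(2))
    then show ?thesis using True e by auto
  next
    case False
    then consider "X j < d" | "X j > 1 - d" by linarith
    then show ?thesis
    proof cases
      case 1
      then show ?thesis using d0(2)[of "X j"] X[of j] d by auto
    next
      case 2
      then show ?thesis using d1(2)[of "X j"] X[of j] d by auto
    qed
  qed
  have "(\<lambda>n. 2 * B * ?m n) \<longlonglongrightarrow> 2 * B * 0"
    using d by (intro tendsto_mult_left compact) auto
  then have "eventually (\<lambda>n. 2 * B * ?m n < e / 2) sequentially"
    using e by (intro order_tendstoD) auto
  then obtain n0 where n0: "\<And>n. n \<ge> n0 \<Longrightarrow> 2 * B * ?m n < e / 2"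
    by (auto simp: eventually_sequentially)
  have "norm ((\<Sum>j<n. \<phi> (X j)) / real n - (?u n * \<phi> 0 + (1 - ?u n) * \<phi> 1) - 0) < e" if n: "n \<ge> max n0 1" for n
  proof -
    have "(\<Sum>j<n. ?\<psi> j) = (\<Sum>j<n. of_bool (X j < 1 / 2) * \<phi> 0 + (1 - of_bool (X j < 1 / 2)) * \<phi> 1)"
      by (intro sum.cong) auto
    also have "\<dots> = (\<Sum>j<n. of_bool (X j < 1 / 2)) * \<phi> 0 + (real n - (\<Sum>j<n. of_bool (X j < 1 / 2))) * \<phi> 1"
      by (simp only: sum.distrib sum_distrib_right[symmetric] sum_subtractf) simp
    finally have \<psi>: "(\<Sum>j<n. ?\<psi> j) / real n = ?u n * \<phi> 0 + (1 - ?u n) * \<phi> 1"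
      using n by (simp add: frequency_def field_simps)
    then have "\<bar>(\<Sum>j<n. \<phi> (X j)) / real n - (?u n * \<phi> 0 + (1 - ?u n) * \<phi> 1)\<bar> =
        \<bar>\<Sum>j<n. \<phi> (X j) - ?\<psi> j\<bar> / real n"
      by (simp only: \<psi>[symmetric] sum_subtractf diff_divide_distrib[symmetric] abs_divide abs_of_nat)
    also have "\<dots> \<le> (\<Sum>j<n. \<bar>\<phi> (X j) - ?\<psi> j\<bar>) / real n"
      by (intro divide_right_mono sum_abs) simp
    also have "\<dots> \<le> (\<Sum>j<n. e / 2 + 2 * B * of_bool (d \<le> X j \<and> X j \<le> 1 - d)) / real n"
      by (intro divide_right_mono sum_mono pointwise) simp
    also have "\<dots> = e / 2 + 2 * B * ?m n"
      using n by (simp only: sum.distrib sum_distrib_left[symmetric] frequency_def add_divide_distrib) simp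
    also have "\<dots> < e" using n0[of n] n by simp
    finally show ?thesis by simp
  qed
  then show "\<exists>n0. \<forall>n\<ge>n0. norm ((\<Sum>j<n. \<phi> (X j)) / real n - (?u n * \<phi> 0 + (1 - ?u n) * \<phi> 1) - 0) < e"
    by blast
qed

text \<open>
  Along any sequence of times tending to infinity, the empirical measure converges if and only if the
  proportion of time spent in \<open>(0, 1/2)\<close> does, and this proportion accumulates at every point of
  \<open>[0, 1]\<close>.
\<close>

lemma accumulation_points_eq_two_point_measures:
  assumes X: "\<And>j. fiber_iter f \<omega> j x \<in> {0<..<1}"
    and compact: "\<And>a b. 0 < a \<Longrightarrow> b < 1 \<Longrightarrow>
      frequency (\<lambda>j. a \<le> fiber_iter f \<omega> j x \<and> fiber_iter f \<omega> j x \<le> b) \<longlonglongrightarrow> 0"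
    and low: "\<And>e. e > 0 \<Longrightarrow> \<exists>\<^sub>\<infinity>n. frequency (\<lambda>j. fiber_iter f \<omega> j x < 1 / 2) n < e"
    and high: "\<And>e. e > 0 \<Longrightarrow> \<exists>\<^sub>\<infinity>n. 1 - e < frequency (\<lambda>j. fiber_iter f \<omega> j x < 1 / 2) n"
  shows "weak_star_accumulation_points f \<omega> x =
      {lincomb_measure [(l, dirac 0), (1 - l, dirac 1)] | l. l \<in> {0..1}}"
proof -
  let ?X = "\<lambda>j. fiber_iter f \<omega> j x" and ?E = "empirical_measure f \<omega> x"
  let ?u = "frequency (\<lambda>j. ?X j < 1 / 2)"
  let ?\<delta> = "\<lambda>l. lincomb_measure [(l, dirac 0), (1 - l, dirac 1)]"
  have X': "?X j \<in> {0..1}" for j using X[of j] by simp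
  have E: "eventually (\<lambda>n. ?E n \<in> prob_measures_I) sequentially"
    using eventually_gt_at_top[of 0] by eventually_elim (rule empirical_measure_in_prob_measures_I[OF _ X'])
  have lim: "(\<lambda>n. (\<integral>y. \<phi> y \<partial>?E n) - (?u n * \<phi> 0 + (1 - ?u n) * \<phi> 1)) \<longlonglongrightarrow> 0"
    if \<phi>: "continuous_on {0..1} \<phi>" for \<phi> :: "real \<Rightarrow> real"
  proof (rule Lim_transform_eventually[OF average_close_to_endpoint_values[OF X compact \<phi>]])
    show "eventually (\<lambda>n. (\<Sum>j<n. \<phi> (?X j)) / real n - (?u n * \<phi> 0 + (1 - ?u n) * \<phi> 1) =
        (\<integral>y. \<phi> y \<partial>?E n) - (?u n * \<phi> 0 + (1 - ?u n) * \<phi> 1)) sequentially"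
      using eventually_gt_at_top[of 0]
      by eventually_elim (simp add: integral_empirical_measure[OF _ X' \<phi>])
  qed
  show ?thesis
  proof (intro equalityI subsetI)
    fix \<mu> assume "\<mu> \<in> weak_star_accumulation_points f \<omega> x"
    then have \<mu>: "\<mu> \<in> prob_measures_I"
      and acc: "\<And>U. openin weak_star_topology U \<Longrightarrow> \<mu> \<in> U \<Longrightarrow> \<exists>\<^sub>F n in sequentially. ?E n \<in> U"
      by (auto simp: weak_star_accumulation_points_def topspace_weak_star_topology)
    let ?\<phi> = "\<lambda>y::real. y * (1 - y)"
    have \<phi>: "continuous_on {0..1} ?\<phi>" by (intro continuous_intros)
    \<comment> \<open>The function vanishes at both endpoints, so its integrals against the empirical measures tend to \<open>0\<close>.\<close>
    have "(\<integral>y. ?\<phi> y \<partial>\<mu>) = 0"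
    proof (rule ccontr)
      assume nz: "(\<integral>y. ?\<phi> y \<partial>\<mu>) \<noteq> 0"
      define c where "c = \<bar>\<integral>y. ?\<phi> y \<partial>\<mu>\<bar>"
      have c: "c > 0" using nz by (simp add: c_def)
      define V where "V = {s::real. c / 2 < \<bar>s\<bar>}"
      have "open V" unfolding V_def by (intro open_Collect_less continuous_intros)
      then have "openin weak_star_topology {\<mu> \<in> prob_measures_I. (\<integral>y. ?\<phi> y \<partial>\<mu>) \<in> V}"
        unfolding weak_star_topology_def using \<phi> by (intro topology_generated_by_Basis) blast
      moreover have "(\<integral>y. ?\<phi> y \<partial>\<mu>) \<in> V" using c by (simp add: V_def c_def)
      ultimately have "\<exists>\<^sub>F n in sequentially. ?E n \<in> {\<mu> \<in> prob_measures_I. (\<integral>y. ?\<phi> y \<partial>\<mu>) \<in> V}"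
        using \<mu> by (intro acc) auto
      then have freq: "\<exists>\<^sub>F n in sequentially. c / 2 < \<bar>\<integral>y. ?\<phi> y \<partial>?E n\<bar>"
        by (rule frequently_elim1) (simp add: V_def)
      have "eventually (\<lambda>n. \<bar>\<integral>y. ?\<phi> y \<partial>?E n\<bar> < c / 2) sequentially"
        using lim[OF \<phi>] c by (intro order_tendstoD(2)[OF tendsto_rabs_zero]) auto
      with freq have "\<exists>\<^sub>F n in sequentially. c / 2 < \<bar>\<integral>y. ?\<phi> y \<partial>?E n\<bar> \<and> \<bar>\<integral>y. ?\<phi> y \<partial>?E n\<bar> < c / 2"
        by (rule frequently_eventually_frequently)
      then show False by (auto dest: frequently_ex)
    qed
    then show "\<mu> \<in> {?\<delta> l | l. l \<in> {0..1}}"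
      using two_point_measureI[OF \<mu>] by auto
  next
    fix \<mu> assume "\<mu> \<in> {?\<delta> l | l. l \<in> {0..1}}"
    then obtain l where l: "l \<in> {0..1}" and \<mu>: "\<mu> = ?\<delta> l" by blast
    obtain r where r: "strict_mono r" "(\<lambda>k. ?u (r k)) \<longlonglongrightarrow> l"
      using frequency_subsequence[OF low high l] by blast
    have sub: "(\<lambda>k. \<integral>y. \<phi> y \<partial>?E (r k)) \<longlonglongrightarrow> (\<integral>y. \<phi> y \<partial>\<mu>)"
      if \<phi>: "continuous_on {0..1} \<phi>" for \<phi> :: "real \<Rightarrow> real"
    proof -
      have "(\<lambda>k. (\<integral>y. \<phi> y \<partial>?E (r k)) - (?u (r k) * \<phi> 0 + (1 - ?u (r k)) * \<phi> 1)) \<longlonglongrightarrow> 0"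
        using LIMSEQ_subseq_LIMSEQ[OF lim[OF \<phi>] r(1)] by (simp add: comp_def)
      moreover have "(\<lambda>k. ?u (r k) * \<phi> 0 + (1 - ?u (r k)) * \<phi> 1) \<longlonglongrightarrow> l * \<phi> 0 + (1 - l) * \<phi> 1"
        by (intro tendsto_intros r(2))
      ultimately have "(\<lambda>k. ((\<integral>y. \<phi> y \<partial>?E (r k)) - (?u (r k) * \<phi> 0 + (1 - ?u (r k)) * \<phi> 1)) +
          (?u (r k) * \<phi> 0 + (1 - ?u (r k)) * \<phi> 1)) \<longlonglongrightarrow> 0 + (l * \<phi> 0 + (1 - l) * \<phi> 1)"
        by (rule tendsto_add)
      then show ?thesis using integral_two_point_measure[OF l \<phi>] by (simp add: \<mu>)
    qed
    have "\<exists>\<^sub>F n in sequentially. ?E n \<in> U" if U: "openin weak_star_topology U" "\<mu> \<in> U" for U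
    proof -
      have "eventually (\<lambda>k. ?E (r k) \<in> U) sequentially"
        using U eventually_subseq[OF r(1) E] sub by (rule eventually_in_weak_star_open)
      then obtain k0 where k0: "\<And>k. k \<ge> k0 \<Longrightarrow> ?E (r k) \<in> U"
        by (auto simp: eventually_sequentially)
      show ?thesis
        unfolding frequently_sequentially
      proof
        fix N
        show "\<exists>n\<ge>N. ?E n \<in> U"
          using k0[of "max N k0"] seq_suble[OF r(1), of "max N k0"] by (intro exI[of _ "r (max N k0)"]) auto
      qed
    qed
    then show "\<mu> \<in> weak_star_accumulation_points f \<omega> x"
      using two_point_measure_in_prob_measures_I[OF l]
      by (simp add: weak_star_accumulation_points_def topspace_weak_star_topology \<mu>)
  qed
qed


section \<open>Orbits of monotone fiber maps\<close>

lemma fiber_iter_add: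
  "fiber_iter f \<omega> (m + k) x = fiber_iter f (\<lambda>i. \<omega> (m + i)) k (fiber_iter f \<omega> m x)"
  by (induction k) simp_all

lemma fiber_iter_cong: "(\<And>i. i < n \<Longrightarrow> \<omega> i = \<omega>' i) \<Longrightarrow> fiber_iter f \<omega> n x = fiber_iter f \<omega>' n x"
  by (induction n) simp_all

lemma start_in_orbit_points: "x \<in> orbit_points f x"
  unfolding orbit_points_def by (force intro: exI[of _ 0])

lemma fiber_iter_in_orbit_points:
  assumes "y \<in> orbit_points f x"
  shows "fiber_iter f \<omega> k y \<in> orbit_points f x"
proof -
  obtain \<eta> m where y: "y = fiber_iter f \<eta> m x" using assms by (auto simp: orbit_points_def)
  let ?\<zeta> = "\<lambda>i. if i < m then \<eta> i else \<omega> (i - m)"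
  have "fiber_iter f ?\<zeta> (m + k) x = fiber_iter f \<omega> k (fiber_iter f ?\<zeta> m x)"
    by (simp add: fiber_iter_add)
  also have "fiber_iter f ?\<zeta> m x = y" unfolding y by (rule fiber_iter_cong) simp
  finally have "fiber_iter f \<omega> k y = fiber_iter f ?\<zeta> (m + k) x" by (rule sym)
  then show ?thesis unfolding orbit_points_def by blast
qed

locale increasing_fibers =
  fixes f :: "'a \<Rightarrow> real \<Rightarrow> real"
  assumes fiber_interior: "\<And>a y. y \<in> {0<..<1} \<Longrightarrow> f a y \<in> {0<..<1}"
    and fiber_mono: "\<And>a. mono_on {0<..<1} (f a)"
begin

lemma fiber_iter_interior: "x \<in> {0<..<1} \<Longrightarrow> fiber_iter f \<omega> n x \<in> {0<..<1}"
proof (induction n)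
  case (Suc n)
  then show ?case using fiber_interior[of "fiber_iter f \<omega> n x" "\<omega> n"] by simp
qed simp

lemma orbit_points_interior: "x \<in> {0<..<1} \<Longrightarrow> orbit_points f x \<subseteq> {0<..<1}"
  using fiber_iter_interior by (auto simp: orbit_points_def)

lemma fiber_iter_mono:
  assumes "x \<in> {0<..<1}" "y \<in> {0<..<1}" "x \<le> y"
  shows "fiber_iter f \<omega> n x \<le> fiber_iter f \<omega> n y"
proof (induction n)
  case (Suc n)
  then show ?case
    using fiber_iter_interior[OF assms(1), of \<omega> n] fiber_iter_interior[OF assms(2), of \<omega> n]
    by (auto intro: mono_onD[OF fiber_mono])
qed (use assms in simp)

definition recurrent_around :: "real \<Rightarrow> bool" where
  "recurrent_around y \<longleftrightarrow>
     (\<exists>\<omega>. (\<exists>\<^sub>\<infinity>n. fiber_iter f \<omega> n y < y) \<and> (\<exists>\<^sub>\<infinity>n. y < fiber_iter f \<omega> n y))"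

text \<open>
  Otherwise the supremum \<open>s\<close> of the orbit of \<open>x\<close> is itself an interior point, and some trajectory of \<open>s\<close>
  first drops below \<open>s\<close> and later rises above it. Once it is below \<open>s\<close>, it is below some point \<open>z\<close> of the
  orbit of \<open>x\<close>. By monotonicity it then stays below the trajectory of \<open>z\<close> driven by the same symbols, which
  never leaves the orbit of \<open>x\<close> and so never exceeds \<open>s\<close>. A symbol \<open>a\<close> with \<open>s < f a s\<close> alone gives no
  contradiction, since \<open>f a\<close> may jump at \<open>s\<close>.
\<close>

lemma orbit_above:
  assumes rec: "\<And>y. y \<in> {0<..<1} \<Longrightarrow> recurrent_around y" and x: "x \<in> {0<..<1}" and b: "b < 1"
  obtains z where "z \<in> orbit_points f x" "b < z"
proof -
  let ?O = "orbit_points f x"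
  define s where "s = Sup ?O"
  have ne: "?O \<noteq> {}" using start_in_orbit_points by blast
  have bdd: "bdd_above ?O" using orbit_points_interior[OF x] by (intro bdd_aboveI[of _ 1]) auto
  have le_s: "z \<le> s" if "z \<in> ?O" for z using cSup_upper[OF that bdd] by (simp add: s_def)
  have "\<not> s < 1"
  proof
    assume "s < 1"
    with le_s[OF start_in_orbit_points] x have s: "s \<in> {0<..<1}" by simp
    then obtain \<omega> where below: "\<exists>\<^sub>\<infinity>n. fiber_iter f \<omega> n s < s" and above: "\<exists>\<^sub>\<infinity>n. s < fiber_iter f \<omega> n s"
      using rec unfolding recurrent_around_def by blast
    obtain m where m: "fiber_iter f \<omega> m s < s" using below by (auto dest: INFM_EX)
    then obtain z where z: "z \<in> ?O" "fiber_iter f \<omega> m s < z"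
      using less_cSup_iff[OF ne bdd] unfolding s_def by blast
    obtain n where n: "n \<ge> m" "s < fiber_iter f \<omega> n s"
      using above unfolding INFM_nat_le by blast
    have "fiber_iter f \<omega> n s = fiber_iter f (\<lambda>i. \<omega> (m + i)) (n - m) (fiber_iter f \<omega> m s)"
      using n(1) fiber_iter_add[of f \<omega> m "n - m" s] by simp
    also have "\<dots> \<le> fiber_iter f (\<lambda>i. \<omega> (m + i)) (n - m) z"
      using z orbit_points_interior[OF x] by (intro fiber_iter_mono fiber_iter_interior[OF s]) auto
    also have "\<dots> \<le> s"
      using z(1) by (intro le_s fiber_iter_in_orbit_points)
    finally show False using n(2) by simp
  qed
  then show ?thesis using less_cSup_iff[OF ne bdd, of b] b that unfolding s_def by auto
qed

text \<open>
  The mirror image of the preceding argument, for the infimum of the orbit.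
\<close>

lemma orbit_below:
  assumes rec: "\<And>y. y \<in> {0<..<1} \<Longrightarrow> recurrent_around y" and x: "x \<in> {0<..<1}" and b: "0 < b"
  obtains z where "z \<in> orbit_points f x" "z < b"
proof -
  let ?O = "orbit_points f x"
  define s where "s = Inf ?O"
  have ne: "?O \<noteq> {}" using start_in_orbit_points by blast
  have bdd: "bdd_below ?O" using orbit_points_interior[OF x] by (intro bdd_belowI[of _ 0]) auto
  have s_le: "s \<le> z" if "z \<in> ?O" for z using cInf_lower[OF that bdd] by (simp add: s_def)
  have "\<not> 0 < s"
  proof
    assume "0 < s"
    with s_le[OF start_in_orbit_points] x have s: "s \<in> {0<..<1}" by simp
    then obtain \<omega> where below: "\<exists>\<^sub>\<infinity>n. fiber_iter f \<omega> n s < s" and above: "\<exists>\<^sub>\<infinity>n. s < fiber_iter f \<omega> n s"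
      using rec unfolding recurrent_around_def by blast
    obtain m where m: "s < fiber_iter f \<omega> m s" using above by (auto dest: INFM_EX)
    then obtain z where z: "z \<in> ?O" "z < fiber_iter f \<omega> m s"
      using cInf_less_iff[OF ne bdd] unfolding s_def by blast
    obtain n where n: "n \<ge> m" "fiber_iter f \<omega> n s < s"
      using below unfolding INFM_nat_le by blast
    have "s \<le> fiber_iter f (\<lambda>i. \<omega> (m + i)) (n - m) z"
      using z(1) by (intro s_le fiber_iter_in_orbit_points)
    also have "\<dots> \<le> fiber_iter f (\<lambda>i. \<omega> (m + i)) (n - m) (fiber_iter f \<omega> m s)"
      using z orbit_points_interior[OF x] by (intro fiber_iter_mono fiber_iter_interior[OF s]) auto
    also have "\<dots> = fiber_iter f \<omega> n s"
      using n(1) fiber_iter_add[of f \<omega> m "n - m" s] by simp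
    finally show False using n(2) by simp
  qed
  then show ?thesis using cInf_less_iff[OF ne bdd, of b] b that unfolding s_def by auto
qed

text \<open>
  The conjugacy \<open>h\<close> is defined only on the orbit, but the orbit reaches arbitrarily close to both
  endpoints. Comparing with orbit points \<open>y\<close> and \<open>z\<close> beyond a given level translates statements about
  the position in \<open>(0, 1)\<close> into statements about the walk: \<open>h\<close> is bounded on the part of the orbit in a
  compact set, bounded above on the part in \<open>(0, 1/2)\<close>, and bounded below on the rest.
\<close>

lemma accumulation_points_of_oscillating:
  assumes rec: "\<And>y. y \<in> {0<..<1} \<Longrightarrow> recurrent_around y" and x: "x \<in> {0<..<1}"
    and h: "strict_mono_on (orbit_points f x) h"
    and osc: "oscillating (\<lambda>n. h (fiber_iter f \<omega> n x) - h x)"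
  shows "weak_star_accumulation_points f \<omega> x =
      {lincomb_measure [(l, dirac 0), (1 - l, dirac 1)] | l. l \<in> {0..1}}"
proof -
  let ?X = "\<lambda>j. fiber_iter f \<omega> j x"
  have X: "?X j \<in> orbit_points f x" for j
    by (rule fiber_iter_in_orbit_points[OF start_in_orbit_points])
  have h_less: "y < z \<Longrightarrow> h y < h z" if "y \<in> orbit_points f x" "z \<in> orbit_points f x" for y z
    using h that by (auto dest: strict_mono_onD)
  show ?thesis
  proof (rule accumulation_points_eq_two_point_measures)
    show "?X j \<in> {0<..<1}" for j by (rule fiber_iter_interior[OF x])
  next
    fix a b :: real assume ab: "0 < a" "b < 1"
    obtain y where y: "y \<in> orbit_points f x" "y < a" using orbit_below[OF rec x ab(1)] .
    obtain z where z: "z \<in> orbit_points f x" "b < z" using orbit_above[OF rec x ab(2)] .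
    obtain K :: nat where K: "\<bar>h y - h x\<bar> + \<bar>h z - h x\<bar> \<le> real K" using real_arch_simple by blast
    have "\<bar>h (?X j) - h x\<bar> \<le> real K" if "a \<le> ?X j \<and> ?X j \<le> b" for j
      using h_less[OF y(1) X, of j] h_less[OF X z(1), of j] that y(2) z(2) K by linarith
    then have le: "frequency (\<lambda>j. a \<le> ?X j \<and> ?X j \<le> b) n \<le> frequency (\<lambda>j. \<bar>h (?X j) - h x\<bar> \<le> real K) n" for n
      by (rule frequency_mono)
    have "frequency (\<lambda>j. \<bar>h (?X j) - h x\<bar> \<le> real K) \<longlonglongrightarrow> 0"
      using osc by (simp add: oscillating_def)
    then show "frequency (\<lambda>j. a \<le> ?X j \<and> ?X j \<le> b) \<longlonglongrightarrow> 0"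
      by (rule Lim_null_comparison[rotated]) (simp add: le frequency_nonneg)
  next
    fix e :: real assume "e > 0"
    then obtain r where r: "1 / real (Suc r) < e" using reals_Archimedean by (auto simp: inverse_eq_divide)
    obtain z where z: "z \<in> orbit_points f x" "1 / 2 < z" using orbit_above[OF rec x, of "1 / 2"] by auto
    obtain K :: nat where K: "h z - h x \<le> real K" using real_arch_simple by blast
    have "h (?X j) - h x \<le> real K" if "?X j < 1 / 2" for j
      using h_less[OF X z(1), of j] that z(2) K by linarith
    then have le: "frequency (\<lambda>j. ?X j < 1 / 2) n \<le> frequency (\<lambda>j. h (?X j) - h x \<le> real K) n" for n
      by (rule frequency_mono)
    have "\<exists>\<^sub>\<infinity>n. frequency (\<lambda>j. h (?X j) - h x \<le> real K) n \<le> 1 / real (Suc r)"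
      using osc unfolding oscillating_def by blast
    then show "\<exists>\<^sub>\<infinity>n. frequency (\<lambda>j. ?X j < 1 / 2) n < e"
    proof (rule INFM_mono)
      show "frequency (\<lambda>j. ?X j < 1 / 2) n < e"
        if "frequency (\<lambda>j. h (?X j) - h x \<le> real K) n \<le> 1 / real (Suc r)" for n
        using le[of n] that r by linarith
    qed
  next
    fix e :: real assume "e > 0"
    then obtain r where r: "1 / real (Suc r) < e" using reals_Archimedean by (auto simp: inverse_eq_divide)
    obtain y where y: "y \<in> orbit_points f x" "y < 1 / 2" using orbit_below[OF rec x, of "1 / 2"] by auto
    obtain K :: nat where K: "h x - h y \<le> real K" using real_arch_simple by blast
    have "- (h (?X j) - h x) \<le> real K" if "\<not> ?X j < 1 / 2" for j
      using h_less[OF y(1) X, of j] that y(2) K by linarith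
    then have le: "frequency (\<lambda>j. \<not> ?X j < 1 / 2) n \<le> frequency (\<lambda>j. - (h (?X j) - h x) \<le> real K) n" for n
      by (rule frequency_mono)
    have inf: "\<exists>\<^sub>\<infinity>n. frequency (\<lambda>j. - (h (?X j) - h x) \<le> real K) n \<le> 1 / real (Suc r)"
      using osc unfolding oscillating_def by blast
    show "\<exists>\<^sub>\<infinity>n. 1 - e < frequency (\<lambda>j. ?X j < 1 / 2) n"
      unfolding INFM_nat_le
    proof
      fix N :: nat
      obtain n where n: "n \<ge> Suc N" "frequency (\<lambda>j. - (h (?X j) - h x) \<le> real K) n \<le> 1 / real (Suc r)"
        using inf unfolding INFM_nat_le by blast
      have "frequency (\<lambda>j. ?X j < 1 / 2) n = 1 - frequency (\<lambda>j. \<not> ?X j < 1 / 2) n"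
        using n(1) by (intro frequency_not) simp
      then show "\<exists>n\<ge>N. 1 - e < frequency (\<lambda>j. ?X j < 1 / 2) n"
        using le[of n] n r by (intro exI[of _ n]) linarith
    qed
  qed
qed

end


section \<open>Empirical measures of skew products conjugate to random walks\<close>

lemma prob_space_bernoulli_measure: "prob_space (bernoulli_measure p)"
  unfolding bernoulli_measure_def by (intro prob_space_PiM measure_pmf.prob_space_axioms)

text \<open>
  A decreasing conjugacy becomes increasing when it is replaced by its negative, which turns the walk
  into the walk with negated steps.
\<close>

lemma conjugate_walk_oscillating:
  assumes conj: "conjugates_to_random_walk p f x G h"
    and mean: "prob_space.expectation (bernoulli_measure p) (walk_step f h x 1) = 0"
    and sq: "integrable (bernoulli_measure p) (\<lambda>\<omega>. (walk_step f h x 1 \<omega>)\<^sup>2)"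
    and var: "prob_space.variance (bernoulli_measure p) (walk_step f h x 1) > 0"
  shows "\<exists>h. strict_mono_on (orbit_points f x) h \<and>
    (AE \<omega> in bernoulli_measure p. oscillating (\<lambda>n. h (fiber_iter f \<omega> n x) - h x))"
proof -
  interpret prob_space "bernoulli_measure p" by (rule prob_space_bernoulli_measure)
  have indep: "indep_vars (\<lambda>_. borel) (walk_step f h x) {1..}"
    and ident: "\<And>n. n \<ge> 1 \<Longrightarrow> distr (bernoulli_measure p) borel (walk_step f h x n) =
        distr (bernoulli_measure p) borel (walk_step f h x 1)"
    using conj unfolding conjugates_to_random_walk_def by blast+
  interpret walk: centered_iid "bernoulli_measure p" "\<lambda>n. walk_step f h x (Suc n)"
  proof
    show "indep_vars (\<lambda>_. borel) (\<lambda>n. walk_step f h x (Suc n)) UNIV"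
      using indep_vars_reindex[OF indep, of Suc UNIV] by auto
    show "distr (bernoulli_measure p) borel (walk_step f h x (Suc n)) =
        distr (bernoulli_measure p) borel (walk_step f h x (Suc 0))" for n
      using ident[of "Suc n"] by simp
  qed (use mean sq var in simp_all)
  have sum: "(\<Sum>i<n. walk_step f h x (Suc i) \<omega>) = h (fiber_iter f \<omega> n x) - h x" for n \<omega>
    using sum_lessThan_telescope[of "\<lambda>i. h (fiber_iter f \<omega> i x)" n] by (simp add: walk_step_def)
  consider "strict_mono_on (orbit_points f x) h" | "strict_antimono_on (orbit_points f x) h"
    using conj unfolding conjugates_to_random_walk_def by blast
  then show ?thesis
  proof cases
    case 1
    then show ?thesis using walk.AE_oscillating unfolding sum by blast
  next
    case 2
    interpret neg: centered_iid "bernoulli_measure p" "\<lambda>n \<omega>. - walk_step f h x (Suc n) \<omega>"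
      by (rule walk.centered_iid_uminus)
    have "strict_mono_on (orbit_points f x) (\<lambda>y. - h y)"
      using 2 by (simp add: monotone_on_def)
    moreover have "AE \<omega> in bernoulli_measure p. oscillating (\<lambda>n. - h (fiber_iter f \<omega> n x) - - h x)"
      using neg.AE_oscillating unfolding sum_negf sum by simp
    ultimately show ?thesis by blast
  qed
qed

theorem corollary3:
  fixes p :: "'a pmf" and f :: "'a \<Rightarrow> real \<Rightarrow> real"
  assumes full_support: "\<And>a. pmf p a > 0"
    and fiber_maps: "\<And>a. f a \<in> borel_I \<rightarrow>\<^sub>M borel_I"
    and random_walk: "\<And>x. x \<in> {0<..<1} \<Longrightarrow>
      \<exists>G \<in> {\<int>, UNIV}. \<exists>h. conjugates_to_random_walk p f x G h \<and>
        integrable (bernoulli_measure p) (walk_step f h x 1) \<and>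
        prob_space.expectation (bernoulli_measure p) (walk_step f h x 1) = 0 \<and>
        integrable (bernoulli_measure p) (\<lambda>\<omega>. (walk_step f h x 1 \<omega>)\<^sup>2) \<and>
        prob_space.variance (bernoulli_measure p) (walk_step f h x 1) > 0"
    and interior: "\<And>\<omega> :: nat \<Rightarrow> 'a.
      f (\<omega> 0) \<in> restrict_space borel {0<..<1} \<rightarrow>\<^sub>M restrict_space borel {0<..<1} \<and>
      mono_on {0<..<1} (f (\<omega> 0))"
    and moves_both_ways: "\<And>x. x \<in> {0<..<1} \<Longrightarrow>
      \<exists>(\<alpha> :: nat \<Rightarrow> 'a) (\<beta> :: nat \<Rightarrow> 'a). f (\<alpha> 0) x < x \<and> x < f (\<beta> 0) x"
    and endpoints: "AE \<omega> in bernoulli_measure p. f (\<omega> 0) 0 = 0 \<and> f (\<omega> 0) 1 = 1"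
  shows "\<forall>x\<in>{0<..<1}. AE \<omega> in bernoulli_measure p.
    weak_star_accumulation_points f \<omega> x =
      {lincomb_measure [(l, dirac 0), (1 - l, dirac 1)] | l. l \<in> {0..1}}"
proof -
  interpret prob_space "bernoulli_measure p" by (rule prob_space_bernoulli_measure)
  interpret increasing_fibers f
  proof
    fix a y assume "y \<in> {0<..<1::real}"
    then show "f a y \<in> {0<..<1}"
      using interior[of "\<lambda>_. a"] measurable_space[of "f a" "restrict_space borel {0<..<1}" "restrict_space borel {0<..<1}" y]
      by (simp add: space_restrict_space)
  next
    show "mono_on {0<..<1} (f a)" for a using interior[of "\<lambda>_. a"] by simp
  qed
  have walk: "\<exists>h. strict_mono_on (orbit_points f x) h \<and>
      (AE \<omega> in bernoulli_measure p. oscillating (\<lambda>n. h (fiber_iter f \<omega> n x) - h x))"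
    if "x \<in> {0<..<1}" for x
    using random_walk[OF that] by (auto intro: conjugate_walk_oscillating)
  have rec: "recurrent_around y" if y: "y \<in> {0<..<1}" for y
  proof -
    obtain h where h: "strict_mono_on (orbit_points f y) h"
      and AE: "AE \<omega> in bernoulli_measure p. oscillating (\<lambda>n. h (fiber_iter f \<omega> n y) - h y)"
      using walk[OF y] by blast
    have "\<exists>\<omega>. oscillating (\<lambda>n. h (fiber_iter f \<omega> n y) - h y)"
    proof (rule ccontr)
      assume "\<not> ?thesis"
      with AE have "AE \<omega> in bernoulli_measure p. False" by simp
      then show False by simp
    qed
    then obtain \<omega> where osc: "oscillating (\<lambda>n. h (fiber_iter f \<omega> n y) - h y)" ..
    have "h (fiber_iter f \<omega> n y) < h y \<longleftrightarrow> fiber_iter f \<omega> n y < y"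
        "h y < h (fiber_iter f \<omega> n y) \<longleftrightarrow> y < fiber_iter f \<omega> n y" for n
      by (rule strict_mono_on_less[OF h]; intro start_in_orbit_points fiber_iter_in_orbit_points)+
    then show ?thesis
      using oscillating_imp_infinitely_often[OF osc] unfolding recurrent_around_def by auto
  qed
  show ?thesis
  proof
    fix x :: real assume x: "x \<in> {0<..<1}"
    obtain h where h: "strict_mono_on (orbit_points f x) h"
      and AE: "AE \<omega> in bernoulli_measure p. oscillating (\<lambda>n. h (fiber_iter f \<omega> n x) - h x)"
      using walk[OF x] by blast
    from AE show "AE \<omega> in bernoulli_measure p. weak_star_accumulation_points f \<omega> x =
        {lincomb_measure [(l, dirac 0), (1 - l, dirac 1)] | l. l \<in> {0..1}}"
      by eventually_elim (rule accumulation_points_of_oscillating[OF rec x h])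
  qed
qed

end
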